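(* Let $1\le p\le\infty$ and $1/p+1/p'=1$. Suppose $X$ is a $p$-multinormed space. Then there exists a family of positive integers $(n_i)_{i\in I}$ so that $X$ is a quotient (as a $p$-multinormed space) of $\big(\sum_{i\in I}\min_p(\ell^{p'}_{n_i})\big)_1$.
   Context: All spaces are over the real field; $\mathbb{N}=\{1,2,\dots\}$. For $1\le p\le\infty$, a $p$-multinormed space is a Banach space $X$ together with, for each $n\in\mathbb{N}$, a norm $\|\cdot\|_n$ (written $\|\cdot\|$) on $\ell^p_n\otimes X$ such that: (1) $\|a\otimes x\|_n=\|a\|\,\|x\|$ for $a\in\ell^p_n$, $x\in X$; (2) $\|w\|_n\ge|\langle a^*\otimes x^*,w\rangle|$ for all $w\in\ell^p_n\otimes X$ and all $a^*\in(\ell^p_n)^*$, $x^*\in X^*$ of norm at most $1$; (3) $\|(T\otimes I_X)w\|_m\le\|T\|\,\|w\|_n$ for all $m,n$, all $T\in B(\ell^p_n,\ell^p_m)$ and all $w\in\ell^p_n\otimes X$. (This is equivalent to giving a left tensorial cross-norm on $\ell^p\otimes X$, or on $c_0\otimes X$ if $p=\infty$.) $X$ is a quotient of a $p$-multinormed space $Y$ if there is a $p$-quotient map $q:Y\to X$, i.e. a linear map such that for every $n$ the map $I_{\ell^p_n}\otimes q:\ell^p_n\otimes Y\to\ell^p_n\otimes X$ is a quotient map (it maps the open unit ball onto the open unit ball). For a Banach space $E$, $\min_p(E)$ is the $p$-multinormed space in which $\ell^p_n\otimes E$ carries the Banach space injective tensor norm. The $\ell^1$ sum $(\sum_iX_i)_1$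 of $p$-multinormed spaces has the Banach space $\ell^1$ sum as its underlying Banach space; an element of its tensor product with $\ell^p_n$ is a family $x=(x_i)$, $x_i\in\ell^p_n\otimes X_i$, and $\|x\|_n=\sum_i\|x_i\|_{\ell^p_n\otimes X_i}$. *)

theory Defs
  imports "HOL-Analysis.Analysis" "HOL-Library.Function_Algebras"
begin

text \<open>Function_Algebras makes functions into an additive group under pointwise operations;
  here they become a real vector space, so that sequence spaces and spaces of families are
  subspaces of a function type.\<close>

instantiation "fun" :: (type, real_vector) real_vector
begin

definition scaleR_fun :: "real \<Rightarrow> ('a \<Rightarrow> 'b) \<Rightarrow> 'a \<Rightarrow> 'b"
  where "scaleR_fun c f = (\<lambda>x. c *\<^sub>R f x)"

instance
  by standard (simp_all add: scaleR_fun_def fun_eq_iff scaleR_add_left scaleR_add_right)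

end

section \<open>Normed spaces on an explicit carrier\<close>

text \<open>The \<open>\<ell>\<^sup>1\<close> sums below depend on a family of dimensions, hence they cannot be types.
  Normed spaces are therefore given by a subspace of a real vector space and a norm, whose
  values outside the carrier are irrelevant.\<close>

record 'a nspace =
  vcarrier :: "'a set"
  vnorm :: "'a \<Rightarrow> real"

definition norm_on :: "'a::real_vector set \<Rightarrow> ('a \<Rightarrow> real) \<Rightarrow> bool" where
  "norm_on V N \<longleftrightarrow>
     (\<forall>x\<in>V. 0 \<le> N x) \<and>
     (\<forall>x\<in>V. N x = 0 \<longleftrightarrow> x = 0) \<and>
     (\<forall>c. \<forall>x\<in>V. N (c *\<^sub>R x) = \<bar>c\<bar> * N x) \<and>
     (\<forall>x\<in>V. \<forall>y\<in>V. N (x + y) \<le> N x + N y)"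

definition banach_space :: "('a::real_vector, 'r) nspace_scheme \<Rightarrow> bool" where
  "banach_space E \<longleftrightarrow>
     subspace (vcarrier E) \<and> norm_on (vcarrier E) (vnorm E) \<and>
     (\<forall>\<sigma>. range \<sigma> \<subseteq> vcarrier E \<and>
          (\<forall>e>0. \<exists>M. \<forall>m\<ge>M. \<forall>n\<ge>M. vnorm E (\<sigma> m - \<sigma> n) < e) \<longrightarrow>
          (\<exists>x\<in>vcarrier E. (\<lambda>k. vnorm E (\<sigma> k - x)) \<longlonglongrightarrow> 0))"

definition lin_on :: "'a::real_vector set \<Rightarrow> ('a \<Rightarrow> 'b::real_vector) \<Rightarrow> bool" where
  "lin_on V f \<longleftrightarrow>
     (\<forall>x\<in>V. \<forall>y\<in>V. f (x + y) = f x + f y) \<and> (\<forall>c. \<forall>x\<in>V. f (c *\<^sub>R x) = c *\<^sub>R f x)"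

definition bounded_ops ::
  "('a::real_vector, 'r) nspace_scheme \<Rightarrow> ('b::real_vector, 's) nspace_scheme \<Rightarrow> ('a \<Rightarrow> 'b) set"
  where "bounded_ops E F =
     {T. T ` vcarrier E \<subseteq> vcarrier F \<and> lin_on (vcarrier E) T \<and>
         (\<exists>C. \<forall>x\<in>vcarrier E. vnorm F (T x) \<le> C * vnorm E x)}"

definition op_norm ::
  "('a::real_vector, 'r) nspace_scheme \<Rightarrow> ('b::real_vector, 's) nspace_scheme \<Rightarrow> ('a \<Rightarrow> 'b) \<Rightarrow> real"
  where "op_norm E F T = Sup {vnorm F (T x) | x. x \<in> vcarrier E \<and> vnorm E x \<le> 1}"

definition dual_ball :: "('a::real_vector, 'r) nspace_scheme \<Rightarrow> ('a \<Rightarrow> real) set" where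
  "dual_ball E = {f. lin_on (vcarrier E) f \<and> (\<forall>x\<in>vcarrier E. \<bar>f x\<bar> \<le> vnorm E x)}"

section \<open>The spaces \<open>\<ell>\<^sup>p\<^sub>n\<close> and their tensor products\<close>

definition unit_vec :: "nat \<Rightarrow> nat \<Rightarrow> real" where
  "unit_vec k = (\<lambda>j. if j = k then 1 else 0)"

definition ell :: "ennreal \<Rightarrow> nat \<Rightarrow> (nat \<Rightarrow> real) nspace" where
  "ell p n = \<lparr>
     vcarrier = {a. \<forall>k\<ge>n. a k = 0},
     vnorm = (\<lambda>a. if p = \<infinity> then Max ((\<lambda>k. \<bar>a k\<bar>) ` {..<n})
                  else (\<Sum>k<n. \<bar>a k\<bar> powr enn2real p) powr (1 / enn2real p))\<rparr>"

text \<open>The algebraic tensor product of \<open>\<real>\<^sup>n\<close> with \<open>V\<close>: the \<open>n\<close>-tuple \<open>w\<close>, extended by \<open>0\<close>,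
  stands for the sum of the elementary tensors of \<open>unit_vec k\<close> and \<open>w k\<close> over \<open>k < n\<close>.
  The next three definitions are the formulas for elementary tensors, for the action of
  a pair of functionals and for the action of an operator on the first factor.\<close>

definition tensor :: "nat \<Rightarrow> 'a::real_vector set \<Rightarrow> (nat \<Rightarrow> 'a) set" where
  "tensor n V = {w. (\<forall>k<n. w k \<in> V) \<and> (\<forall>k\<ge>n. w k = 0)}"

definition elem_tensor :: "(nat \<Rightarrow> real) \<Rightarrow> 'a::real_vector \<Rightarrow> nat \<Rightarrow> 'a" where
  "elem_tensor a x = (\<lambda>k. a k *\<^sub>R x)"

definition tensor_pairing ::
  "nat \<Rightarrow> ((nat \<Rightarrow> real) \<Rightarrow> real) \<Rightarrow> ('a \<Rightarrow> real) \<Rightarrow> (nat \<Rightarrow> 'a) \<Rightarrow> real"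
  where "tensor_pairing n f g w = (\<Sum>k<n. f (unit_vec k) * g (w k))"

definition tensor_left ::
  "nat \<Rightarrow> ((nat \<Rightarrow> real) \<Rightarrow> nat \<Rightarrow> real) \<Rightarrow> (nat \<Rightarrow> 'a::real_vector) \<Rightarrow> nat \<Rightarrow> 'a"
  where "tensor_left n T w = (\<Sum>k<n. elem_tensor (T (unit_vec k)) (w k))"

definition tensor_right :: "('a \<Rightarrow> 'b) \<Rightarrow> (nat \<Rightarrow> 'a) \<Rightarrow> nat \<Rightarrow> 'b" where
  "tensor_right q w = (\<lambda>k. q (w k))"

section \<open>\<open>p\<close>-multinormed spaces\<close>

text \<open>The norm \<open>tnorm X n\<close> on the tensor product with \<open>\<ell>\<^sup>p\<^sub>n\<close> is meaningful for \<open>n \<ge> 1\<close> only.\<close>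

record 'a mnspace = "'a nspace" +
  tnorm :: "nat \<Rightarrow> (nat \<Rightarrow> 'a) \<Rightarrow> real"

definition multinormed :: "ennreal \<Rightarrow> 'a::real_vector mnspace \<Rightarrow> bool" where
  "multinormed p X \<longleftrightarrow>
     banach_space X \<and>
     (\<forall>n\<ge>1. norm_on (tensor n (vcarrier X)) (tnorm X n)) \<and>
     (\<forall>n\<ge>1. \<forall>a\<in>vcarrier (ell p n). \<forall>x\<in>vcarrier X.
        tnorm X n (elem_tensor a x) = vnorm (ell p n) a * vnorm X x) \<and>
     (\<forall>n\<ge>1. \<forall>w\<in>tensor n (vcarrier X). \<forall>f\<in>dual_ball (ell p n). \<forall>g\<in>dual_ball X.
        \<bar>tensor_pairing n f g w\<bar> \<le> tnorm X n w) \<and>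
     (\<forall>m\<ge>1. \<forall>n\<ge>1. \<forall>T\<in>bounded_ops (ell p n) (ell p m). \<forall>w\<in>tensor n (vcarrier X).
        tnorm X m (tensor_left n T w) \<le> op_norm (ell p n) (ell p m) T * tnorm X n w)"

definition quotient_map :: "'a::real_vector mnspace \<Rightarrow> 'b::real_vector mnspace \<Rightarrow> ('a \<Rightarrow> 'b) \<Rightarrow> bool" where
  "quotient_map Y X q \<longleftrightarrow>
     q ` vcarrier Y \<subseteq> vcarrier X \<and> lin_on (vcarrier Y) q \<and>
     (\<forall>n\<ge>1. tensor_right q ` {w \<in> tensor n (vcarrier Y). tnorm Y n w < 1} =
             {w \<in> tensor n (vcarrier X). tnorm X n w < 1})"

definition is_quotient :: "ennreal \<Rightarrow> 'b::real_vector mnspace \<Rightarrow> 'a::real_vector mnspace \<Rightarrow> bool" where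
  "is_quotient p X Y \<longleftrightarrow> multinormed p X \<and> multinormed p Y \<and> (\<exists>q. quotient_map Y X q)"

definition min_space :: "ennreal \<Rightarrow> 'a::real_vector nspace \<Rightarrow> 'a mnspace" where
  "min_space p E = \<lparr>
     vcarrier = vcarrier E,
     vnorm = vnorm E,
     tnorm = (\<lambda>n w. Sup {\<bar>tensor_pairing n f g w\<bar> | f g. f \<in> dual_ball (ell p n) \<and> g \<in> dual_ball E})\<rparr>"

definition l1_sum :: "'i set \<Rightarrow> ('i \<Rightarrow> 'a::real_vector mnspace) \<Rightarrow> ('i \<Rightarrow> 'a) mnspace" where
  "l1_sum I X = \<lparr>
     vcarrier = {x. (\<forall>i\<in>I. x i \<in> vcarrier (X i)) \<and> (\<forall>i. i \<notin> I \<longrightarrow> x i = 0) \<and>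
                    (\<lambda>i. vnorm (X i) (x i)) summable_on I},
     vnorm = (\<lambda>x. \<Sum>\<^sub>\<infinity>i\<in>I. vnorm (X i) (x i)),
     tnorm = (\<lambda>n w. \<Sum>\<^sub>\<infinity>i\<in>I. tnorm (X i) n (\<lambda>k. w k i))\<rparr>"

text \<open>The Banach space given by the type, with norms \<open>N n\<close> on its tensor products.\<close>

definition type_mnspace :: "(nat \<Rightarrow> (nat \<Rightarrow> 'x) \<Rightarrow> real) \<Rightarrow> 'x::banach mnspace" where
  "type_mnspace N = \<lparr>vcarrier = UNIV, vnorm = norm, tnorm = N\<rparr>"

end

theory Submission
  imports Defs
begin

text \<open>An element \<open>w = (w\<^sub>1, \<dots>, w\<^sub>n)\<close> of \<open>\<ell>\<^sup>p\<^sub>n \<otimes> X\<close> is the image of the identity tensor of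
  \<open>\<ell>\<^sup>p\<^sub>n \<otimes> \<ell>\<^sup>p\<^sup>'\<^sub>n\<close>, which has injective norm at most \<open>1\<close>, under the map
  \<open>b \<mapsto> \<Sum>\<^sub>k b\<^sub>k w\<^sub>k\<close> from \<open>\<ell>\<^sup>p\<^sup>'\<^sub>n\<close> to \<open>X\<close>. If \<open>w\<close> has norm at most \<open>1\<close>, this map is a
  contraction for the minimal structure: an element of \<open>\<ell>\<^sup>p\<^sub>m \<otimes> \<ell>\<^sup>p\<^sup>'\<^sub>n\<close> is an operator \<open>T\<close> from
  \<open>\<ell>\<^sup>p\<^sub>n\<close> to \<open>\<ell>\<^sup>p\<^sub>m\<close> with \<open>\<parallel>T\<parallel>\<close> equal to its injective norm, and its image is \<open>(T \<otimes> I) w\<close>.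
  Hence the sum of these maps over all \<open>n\<close> and all \<open>w\<close> in the unit balls is a quotient map.\<close>

section \<open>Duality of finite-dimensional \<open>\<ell>\<^sup>p\<close> spaces\<close>

lemma one_divide_eq_one_ennreal:
  fixes x :: ennreal
  assumes "1 / x = 1"
  shows "x = 1"
proof (cases x)
  case (real r)
  then have "r \<noteq> 0" using assms by (auto simp: divide_ennreal_def)
  then have "ennreal (1 / r) = ennreal 1"
    using assms real divide_ennreal[of 1 r] by simp
  then have "1 / r = 1" using real by (subst (asm) ennreal_inj) auto
  then show ?thesis using real by simp
qed (use assms in simp)

text \<open>The endpoints are separated because \<open>ell\<close> has its own formula at
  \<open>\<infinity>\<close> and because Young's inequality wants both exponents real and above 1.
  In the finite case the reciprocals are positive reals with sum 1, so each is below 1 and each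
  exponent exceeds 1.\<close>

lemma conjugate_exponent_cases:
  fixes p p' :: ennreal
  assumes "1 / p + 1 / p' = 1"
  obtains (one) "p = 1" "p' = \<infinity>"
  | (infinity) "p = \<infinity>" "p' = 1"
  | (real) r s where "p = ennreal r" "p' = ennreal s" "1 < r" "1 < s" "1 / r + 1 / s = 1"
proof (cases p)
  case top
  then have "1 / p' = 1" using assms by simp
  then have "p' = 1" by (rule one_divide_eq_one_ennreal)
  then show ?thesis using top that by simp
next
  case (real r)
  show ?thesis
  proof (cases p')
    case top
    then have "1 / p = 1" using assms by simp
    then have "p = 1" by (rule one_divide_eq_one_ennreal)
    then show ?thesis using top that by simp
  next
    case s: (real s)
    \<comment> \<open>In \<open>ennreal\<close>, \<open>1 / 0\<close> is infinite, so a zero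
      exponent contradicts the equation.\<close>
    have nz: "r \<noteq> 0" "s \<noteq> 0"
      using assms real s by (auto simp: divide_ennreal_def)
    then have pos: "r > 0" "s > 0" using real s by auto
    then have "ennreal (1 / r + 1 / s) = ennreal 1"
      using assms real s by (simp add: divide_ennreal ennreal_plus flip: ennreal_1 del: ennreal_plus[symmetric])
    then have eq: "1 / r + 1 / s = 1"
      using pos by (subst (asm) ennreal_inj) auto
    then have "1 / r < 1" "1 / s < 1" using pos by (smt (verit) divide_pos_pos)+
    then show ?thesis using that(3)[of r s] real s eq pos by simp
  qed
qed

lemma conjugate_exponent_sym:
  fixes p p' :: ennreal
  shows "1 / p + 1 / p' = 1 \<longleftrightarrow> 1 / p' + 1 / p = 1"
  by (simp add: add.commute)

section \<open>Hoelder's inequality and norming vectors\<close>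

lemma vcarrier_ell: "vcarrier (ell p n) = {a. \<forall>k\<ge>n. a k = 0}"
  by (simp add: ell_def)

lemma vnorm_ell_infinity: "vnorm (ell \<infinity> n) a = Max ((\<lambda>k. \<bar>a k\<bar>) ` {..<n})"
  by (simp add: ell_def)

lemma vnorm_ell_one: "vnorm (ell 1 n) a = (\<Sum>k<n. \<bar>a k\<bar>)"
  by (simp add: ell_def sum_nonneg)

lemma vnorm_ell_real:
  "1 \<le> r \<Longrightarrow> vnorm (ell (ennreal r) n) a = (\<Sum>k<n. \<bar>a k\<bar> powr r) powr (1 / r)"
  by (simp add: ell_def)

text \<open>Young's inequality applied termwise to the normalised vectors. If one of the power sums
  is 0, that vector vanishes on \<open>A\<close> and so does the left side.\<close>

lemma Hoelder_inequality_sum: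
  fixes a b :: "'a \<Rightarrow> real"
  assumes "finite A" and rs: "1 < r" "1 < s" "1 / r + 1 / s = 1"
  shows "(\<Sum>k\<in>A. \<bar>a k * b k\<bar>) \<le>
    (\<Sum>k\<in>A. \<bar>a k\<bar> powr r) powr (1 / r) * (\<Sum>k\<in>A. \<bar>b k\<bar> powr s) powr (1 / s)"
    (is "_ \<le> ?a powr _ * ?b powr _")
proof (cases "?a = 0 \<or> ?b = 0")
  case True
  then have "(\<forall>k\<in>A. a k = 0) \<or> (\<forall>k\<in>A. b k = 0)"
    using \<open>finite A\<close> by (auto simp: sum_nonneg_eq_0_iff)
  then have "(\<Sum>k\<in>A. \<bar>a k * b k\<bar>) = 0" by auto
  then show ?thesis by (simp add: sum_nonneg)
next
  case False
  then have pos: "?a > 0" "?b > 0" by (simp_all add: less_le sum_nonneg)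
  \<comment> \<open>These are the two norms; after division by them the Young bounds add up to
    \<open>1 / r + 1 / s\<close>.\<close>
  define \<alpha> \<beta> where "\<alpha> = ?a powr (1 / r)" and "\<beta> = ?b powr (1 / s)"
  have \<alpha>: "\<alpha> > 0" "\<alpha> powr r = ?a" and \<beta>: "\<beta> > 0" "\<beta> powr s = ?b"
    using pos rs by (auto simp: \<alpha>_def \<beta>_def powr_powr)
  have "(\<Sum>k\<in>A. (\<bar>a k\<bar> / \<alpha>) * (\<bar>b k\<bar> / \<beta>)) \<le>
      (\<Sum>k\<in>A. (\<bar>a k\<bar> / \<alpha>) powr r / r + (\<bar>b k\<bar> / \<beta>) powr s / s)"
    using rs \<alpha> \<beta> by (intro sum_mono Youngs_inequality) auto
  also have "\<dots> = (\<Sum>k\<in>A. \<bar>a k\<bar> powr r / (?a * r) + \<bar>b k\<bar> powr s / (?b * s))"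
    using \<alpha> \<beta> by (simp add: powr_divide)
  also have "\<dots> = ?a / (?a * r) + ?b / (?b * s)"
    by (simp only: sum.distrib sum_divide_distrib)
  also have "\<dots> = 1" using pos rs by simp
  finally have "(\<Sum>k\<in>A. \<bar>a k * b k\<bar>) / (\<alpha> * \<beta>) \<le> 1"
    by (simp add: sum_divide_distrib abs_mult)
  then show ?thesis using \<alpha>(1) \<beta>(1) by (simp add: divide_le_eq flip: \<alpha>_def \<beta>_def)
qed

lemma ell_Hoelder:
  assumes "1 / p + 1 / p' = 1" and "n \<ge> 1"
  shows "\<bar>\<Sum>k<n. a k * b k\<bar> \<le> vnorm (ell p n) a * vnorm (ell p' n) b"
proof -
  \<comment> \<open>One estimate serves both endpoint pairs, with the roles of the vectors
    exchanged.\<close>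
  have *: "\<bar>\<Sum>k<n. a k * b k\<bar> \<le> (\<Sum>k<n. \<bar>a k\<bar>) * vnorm (ell \<infinity> n) b" for a b
  proof -
    have "\<bar>\<Sum>k<n. a k * b k\<bar> \<le> (\<Sum>k<n. \<bar>a k\<bar> * \<bar>b k\<bar>)"
      using sum_abs[of "\<lambda>k. a k * b k" "{..<n}"] by (simp add: abs_mult)
    also have "\<dots> \<le> (\<Sum>k<n. \<bar>a k\<bar> * vnorm (ell \<infinity> n) b)"
      unfolding vnorm_ell_infinity by (intro sum_mono mult_left_mono Max_ge) auto
    finally show ?thesis by (simp add: sum_distrib_right)
  qed
  show ?thesis
    using assms(1)
  proof (cases rule: conjugate_exponent_cases)
    case one
    then show ?thesis using *[of a b] by (simp add: vnorm_ell_one)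
  next
    case infinity
    then show ?thesis using *[of b a] by (simp add: vnorm_ell_one mult.commute)
  next
    case (real r s)
    show ?thesis
      using order_trans[OF sum_abs Hoelder_inequality_sum[of "{..<n}" r s a b]] real
      by (simp add: vnorm_ell_real)
  qed
qed

text \<open>The equality case of Hoelder's inequality: the signs of \<open>v\<close> for
  \<open>p = 1\<close>, the sign at one coordinate of maximal modulus for
  \<open>p = \<infinity>\<close>, and otherwise the signs times
  \<open>\<bar>v k\<bar> powr (r - 1)\<close>, normalised. It exhibits the norm as a maximum over
  the dual unit ball, which is the form used from here on.\<close>

lemma ell_norming:
  assumes "1 / p + 1 / p' = 1" and "n \<ge> 1"
  obtains y where "y \<in> vcarrier (ell p' n)" "vnorm (ell p' n) y \<le> 1"
    "(\<Sum>k<n. v k * y k) = vnorm (ell p n) v"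
  using assms(1)
proof (cases rule: conjugate_exponent_cases)
  case one
  show ?thesis
  proof (rule that)
    let ?y = "\<lambda>k. if k < n then sgn (v k) else 0"
    show "?y \<in> vcarrier (ell p' n)" by (simp add: vcarrier_ell)
    show "vnorm (ell p' n) ?y \<le> 1"
      unfolding one vnorm_ell_infinity using assms(2) by (subst Max_le_iff) (auto simp: sgn_real_def lessThan_empty_iff)
    show "(\<Sum>k<n. v k * ?y k) = vnorm (ell p n) v"
      unfolding one vnorm_ell_one by (intro sum.cong) (auto simp: sgn_real_def)
  qed
next
  case infinity
  have "vnorm (ell p n) v \<in> (\<lambda>k. \<bar>v k\<bar>) ` {..<n}"
    unfolding infinity vnorm_ell_infinity using assms(2) by (intro Max_in) (auto simp: lessThan_empty_iff)
  then obtain i where i: "i < n" "vnorm (ell p n) v = \<bar>v i\<bar>" by auto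
  show ?thesis
  proof (rule that)
    let ?y = "\<lambda>k. if k = i then sgn (v i) else 0"
    show "?y \<in> vcarrier (ell p' n)" using i by (simp add: vcarrier_ell)
    have "vnorm (ell p' n) ?y = (\<Sum>k<n. if k = i then \<bar>sgn (v i)\<bar> else 0)"
      unfolding infinity vnorm_ell_one by (intro sum.cong) auto
    then show "vnorm (ell p' n) ?y \<le> 1" using i by (simp add: sgn_real_def)
    have "(\<Sum>k<n. v k * ?y k) = (\<Sum>k<n. if k = i then \<bar>v i\<bar> else 0)"
      by (intro sum.cong) (auto simp: sgn_real_def)
    then show "(\<Sum>k<n. v k * ?y k) = vnorm (ell p n) v" using i by simp
  qed
next
  case (real r s)
  define S where "S = (\<Sum>k<n. \<bar>v k\<bar> powr r)"
  have norm_v: "vnorm (ell p n) v = S powr (1 / r)" using real by (simp add: vnorm_ell_real S_def)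
  show ?thesis
  proof (cases "S = 0")
    case True
    show ?thesis
      by (rule that[of "\<lambda>_. 0"])
        (use True real norm_v in \<open>simp_all add: vcarrier_ell vnorm_ell_real\<close>)
  next
    case False
    then have S: "S > 0" by (simp add: S_def less_le sum_nonneg)
    \<comment> \<open>The first identity turns \<open>\<bar>?y k\<bar> powr s\<close> into
      \<open>\<bar>v k\<bar> powr r / S\<close>; the second evaluates the pairing to
      \<open>S powr (1 / r)\<close>.\<close>
    have rs: "(r - 1) * s = r" "1 - 1 / s = 1 / r" using real by (auto simp: field_simps)
    let ?y = "\<lambda>k. if k < n then sgn (v k) * \<bar>v k\<bar> powr (r - 1) / S powr (1 / s) else 0"
    show ?thesis
    proof (rule that)
      show "?y \<in> vcarrier (ell p' n)" by (simp add: vcarrier_ell)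
      have "(\<Sum>k<n. \<bar>?y k\<bar> powr s) = (\<Sum>k<n. \<bar>v k\<bar> powr r / S)"
        using real S rs
        by (intro sum.cong) (auto simp: abs_mult sgn_real_def powr_divide powr_powr)
      also have "\<dots> = 1" using S by (simp add: S_def flip: sum_divide_distrib)
      finally show "vnorm (ell p' n) ?y \<le> 1" using real by (simp add: vnorm_ell_real)
      have y: "v k * ?y k = \<bar>v k\<bar> powr r / S powr (1 / s)" if "k < n" for k
        using that by (auto simp: sgn_real_def powr_diff)
      have "(\<Sum>k<n. v k * ?y k) = (\<Sum>k<n. \<bar>v k\<bar> powr r / S powr (1 / s))"
        by (intro sum.cong refl y) simp
      also have "\<dots> = S / S powr (1 / s)" by (simp add: S_def sum_divide_distrib)
      also have "\<dots> = S powr (1 / r)"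
        using S powr_diff[of S 1 "1 / s"] unfolding rs by simp
      finally show "(\<Sum>k<n. v k * ?y k) = vnorm (ell p n) v" using norm_v by simp
    qed
  qed
qed

section \<open>Normed spaces on a carrier\<close>

lemma sum_fun_apply: "(\<Sum>i\<in>A. f i) x = (\<Sum>i\<in>A. f i x)"
  by (induction A rule: infinite_finite_induct) auto

lemma scaleR_fun_apply [simp]: "(c *\<^sub>R f) x = c *\<^sub>R f x"
  by (simp add: scaleR_fun_def)

lemma lin_on_add: "lin_on V f \<Longrightarrow> x \<in> V \<Longrightarrow> y \<in> V \<Longrightarrow> f (x + y) = f x + f y"
  by (simp add: lin_on_def)

lemma lin_on_scaleR: "lin_on V f \<Longrightarrow> x \<in> V \<Longrightarrow> f (c *\<^sub>R x) = c *\<^sub>R f x"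
  by (simp add: lin_on_def)

lemma lin_on_0: "subspace V \<Longrightarrow> lin_on V f \<Longrightarrow> f 0 = 0"
  using lin_on_scaleR[of V f 0 0] by (simp add: subspace_0)

lemma lin_on_diff:
  assumes "subspace V" "lin_on V f" "x \<in> V" "y \<in> V"
  shows "f (x - y) = f x - f y"
  using lin_on_add[of V f "x - y" y] assms by (simp add: subspace_diff)

lemma lin_on_sum:
  assumes "subspace V" "lin_on V f" "\<And>k. k \<in> A \<Longrightarrow> x k \<in> V"
  shows "f (\<Sum>k\<in>A. x k) = (\<Sum>k\<in>A. f (x k))"
  using assms(3)
  by (induction A rule: infinite_finite_induct)
    (use assms(1,2) in \<open>auto simp: lin_on_0 lin_on_add subspace_sum\<close>)

lemma norm_onD:
  assumes "norm_on V \<nu>"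
  shows norm_on_ge_0: "x \<in> V \<Longrightarrow> 0 \<le> \<nu> x"
    and norm_on_eq_0: "x \<in> V \<Longrightarrow> \<nu> x = 0 \<longleftrightarrow> x = 0"
    and norm_on_scaleR: "x \<in> V \<Longrightarrow> \<nu> (c *\<^sub>R x) = \<bar>c\<bar> * \<nu> x"
    and norm_on_triangle: "x \<in> V \<Longrightarrow> y \<in> V \<Longrightarrow> \<nu> (x + y) \<le> \<nu> x + \<nu> y"
  using assms by (simp_all add: norm_on_def)

lemma norm_on_0: "subspace V \<Longrightarrow> norm_on V \<nu> \<Longrightarrow> \<nu> 0 = 0"
  by (simp add: norm_on_eq_0 subspace_0)

lemma norm_on_sum:
  assumes "subspace V" "norm_on V \<nu>" "\<And>k. k \<in> A \<Longrightarrow> x k \<in> V"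
  shows "\<nu> (\<Sum>k\<in>A. x k) \<le> (\<Sum>k\<in>A. \<nu> (x k))"
  using assms(3)
proof (induction A rule: infinite_finite_induct)
  case (insert k A)
  have "\<nu> (x k + sum x A) \<le> \<nu> (x k) + \<nu> (sum x A)"
    using insert assms(1,2) by (intro norm_on_triangle[of V]) (auto simp: subspace_sum)
  then show ?case using insert by fastforce
qed (use assms(1,2) in \<open>simp_all add: norm_on_0\<close>)

lemma banach_spaceD:
  assumes "banach_space E"
  shows banach_space_subspace: "subspace (vcarrier E)"
    and banach_space_norm_on: "norm_on (vcarrier E) (vnorm E)"
  using assms by (simp_all add: banach_space_def)

lemma dual_ballD:
  assumes "f \<in> dual_ball E"
  shows dual_ball_lin_on: "lin_on (vcarrier E) f"
    and dual_ball_bound: "x \<in> vcarrier E \<Longrightarrow> \<bar>f x\<bar> \<le> vnorm E x"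
  using assms by (simp_all add: dual_ball_def)

text \<open>Keeps the set of pairings whose supremum is the minimal tensor norm nonempty, and makes
  that norm nonnegative.\<close>

lemma zero_in_dual_ball: "norm_on (vcarrier E) (vnorm E) \<Longrightarrow> (\<lambda>_. 0) \<in> dual_ball E"
  by (simp add: dual_ball_def lin_on_def norm_on_ge_0)

lemma bounded_opsD:
  assumes "T \<in> bounded_ops E F"
  shows bounded_ops_closed: "x \<in> vcarrier E \<Longrightarrow> T x \<in> vcarrier F"
    and bounded_ops_lin_on: "lin_on (vcarrier E) T"
    and bounded_ops_bound: "\<exists>C. \<forall>x\<in>vcarrier E. vnorm F (T x) \<le> C * vnorm E x"
  using assms by (auto simp: bounded_ops_def)

context
  fixes E :: "('a::real_vector, 'r) nspace_scheme" and F :: "('b::real_vector, 's) nspace_scheme"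
  assumes E: "subspace (vcarrier E)" "norm_on (vcarrier E) (vnorm E)"
    and F: "subspace (vcarrier F)" "norm_on (vcarrier F) (vnorm F)"
begin

text \<open>A real \<open>Sup\<close> bounds its elements only if the set is bounded above; the
  constant from \<open>bounded_ops\<close> provides this.\<close>

lemma op_norm_upper:
  assumes T: "T \<in> bounded_ops E F" and x: "x \<in> vcarrier E" "vnorm E x \<le> 1"
  shows "vnorm F (T x) \<le> op_norm E F T"
proof -
  obtain C where C: "\<And>x. x \<in> vcarrier E \<Longrightarrow> vnorm F (T x) \<le> C * vnorm E x"
    using bounded_ops_bound[OF T] by blast
  \<comment> \<open>\<open>C\<close> may be negative, hence the absolute value.\<close>
  have "vnorm F (T x) \<le> \<bar>C\<bar>" if "x \<in> vcarrier E" "vnorm E x \<le> 1" for x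
  proof -
    have "C * vnorm E x \<le> \<bar>C\<bar> * 1"
      using that norm_on_ge_0[OF E(2)] by (intro mult_mono) auto
    then show ?thesis using C[OF that(1)] by simp
  qed
  then show ?thesis
    unfolding op_norm_def using x by (intro cSup_upper bdd_aboveI[of _ "\<bar>C\<bar>"]) auto
qed

lemma op_norm_ge_0:
  assumes "T \<in> bounded_ops E F"
  shows "0 \<le> op_norm E F T"
  using op_norm_upper[OF assms, of 0] norm_on_ge_0[OF F(2), of "T 0"] bounded_ops_closed[OF assms, of 0]
  by (simp add: subspace_0[OF E(1)] norm_on_0[OF E])

lemma op_norm_bound:
  assumes T: "T \<in> bounded_ops E F" and x: "x \<in> vcarrier E"
  shows "vnorm F (T x) \<le> op_norm E F T * vnorm E x"
proof (cases "x = 0")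
  case True
  then show ?thesis
    using lin_on_0[OF E(1) bounded_ops_lin_on[OF T]] norm_on_0[OF E] norm_on_0[OF F] by simp
next
  case False
  then have pos: "vnorm E x > 0"
    using norm_on_ge_0[OF E(2) x] norm_on_eq_0[OF E(2) x] by simp
  define u where "u = inverse (vnorm E x) *\<^sub>R x"
  have "u \<in> vcarrier E" "vnorm E u = 1"
    using x pos norm_on_scaleR[OF E(2) x] by (auto simp: u_def E(1) subspace_scale)
  then have "vnorm F (T u) \<le> op_norm E F T" using op_norm_upper[OF T] by simp
  moreover have "vnorm F (T u) = inverse (vnorm E x) * vnorm F (T x)"
    using lin_on_scaleR[OF bounded_ops_lin_on[OF T] x] pos
      norm_on_scaleR[OF F(2) bounded_ops_closed[OF T x]] by (simp add: u_def)
  ultimately show ?thesis using pos by (simp add: field_simps)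
qed

lemma op_norm_le:
  assumes "\<And>x. x \<in> vcarrier E \<Longrightarrow> vnorm E x \<le> 1 \<Longrightarrow> vnorm F (T x) \<le> C"
  shows "op_norm E F T \<le> C"
proof -
  have "0 \<in> vcarrier E \<and> vnorm E 0 \<le> 1" using E by (simp add: subspace_0 norm_on_0)
  then show ?thesis unfolding op_norm_def using assms by (intro cSup_least) auto
qed

end

section \<open>Coordinates in \<open>ell p n\<close>\<close>

lemma subspace_ell: "subspace (vcarrier (ell p n))"
  by (simp add: vcarrier_ell subspace_def)

lemma unit_vec_in_ell: "k < n \<Longrightarrow> unit_vec k \<in> vcarrier (ell p n)"
  by (simp add: vcarrier_ell unit_vec_def)

lemma vnorm_unit_vec:
  assumes "k < n"
  shows "vnorm (ell p n) (unit_vec k) = 1"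
proof -
  have "Max ((\<lambda>j. \<bar>unit_vec k j\<bar>) ` {..<n}) = 1"
    using assms by (intro Max_eqI) (auto simp: unit_vec_def image_iff)
  moreover have "(\<Sum>j<n. \<bar>unit_vec k j\<bar> powr r) = (\<Sum>j<n. if j = k then 1 else 0)" for r
    by (intro sum.cong) (auto simp: unit_vec_def)
  ultimately show ?thesis using assms by (simp add: ell_def)
qed

lemma sum_unit_vec: "k < n \<Longrightarrow> (\<Sum>j<n. unit_vec k j * a j) = a k"
  "k < n \<Longrightarrow> (\<Sum>j<n. a j * unit_vec k j) = a k"
  by (simp_all add: unit_vec_def if_distrib[of "\<lambda>x. x * _"] if_distrib[of "\<lambda>x. _ * x"] cong: if_cong)

lemma ell_expansion:
  assumes "a \<in> vcarrier (ell p n)"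
  shows "a = (\<Sum>k<n. a k *\<^sub>R unit_vec k)"
proof
  fix j
  show "a j = (\<Sum>k<n. a k *\<^sub>R unit_vec k) j"
    using assms by (auto simp: vcarrier_ell sum_fun_apply unit_vec_def if_distrib[of "\<lambda>x. _ * x"] cong: if_cong)
qed

lemma lin_on_ell_expansion:
  assumes "lin_on (vcarrier (ell p n)) f" "a \<in> vcarrier (ell p n)"
  shows "f a = (\<Sum>k<n. a k *\<^sub>R f (unit_vec k))"
proof -
  have "f a = f (\<Sum>k<n. a k *\<^sub>R unit_vec k)" using ell_expansion[OF assms(2)] by simp
  also have "\<dots> = (\<Sum>k<n. f (a k *\<^sub>R unit_vec k))"
    by (rule lin_on_sum[OF subspace_ell assms(1)]) (auto simp: subspace_scale subspace_ell unit_vec_in_ell)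
  also have "\<dots> = (\<Sum>k<n. a k *\<^sub>R f (unit_vec k))"
    by (intro sum.cong refl lin_on_scaleR[OF assms(1)]) (simp add: unit_vec_in_ell)
  finally show ?thesis .
qed

lemma subspace_tensor:
  assumes "subspace V"
  shows "subspace (tensor n V)"
  using assms by (auto simp: subspace_def tensor_def)

text \<open>With \<open>w\<close> a tensor over \<open>X\<close>, these are the maps from
  \<open>ell p' n\<close> to \<open>X\<close> out of which the quotient map is assembled.\<close>

lemma lin_on_combination: "lin_on V (\<lambda>a. \<Sum>k<n. a k *\<^sub>R w k)"
  by (auto simp: lin_on_def sum.distrib scaleR_add_left scaleR_sum_right)

section \<open>The norm and the completeness of \<open>ell p n\<close>\<close>

context
  fixes p p' :: ennreal and n :: nat
  assumes conj: "1 / p + 1 / p' = 1" and n: "n \<ge> 1"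
begin

lemma ell_norm_ge_0: "0 \<le> vnorm (ell p n) a"
proof (cases "p = \<infinity>")
  case True
  have "0 \<le> \<bar>a 0\<bar>" by simp
  also have "\<dots> \<le> Max ((\<lambda>k. \<bar>a k\<bar>) ` {..<n})" using n by (intro Max_ge) auto
  finally show ?thesis using True by (simp add: ell_def)
qed (simp add: ell_def)

text \<open>Hoelder's inequality against \<open>unit_vec k\<close>, whose conjugate norm is
  1.\<close>

lemma ell_coord_le:
  assumes "k < n"
  shows "\<bar>a k\<bar> \<le> vnorm (ell p n) a"
  using ell_Hoelder[OF conj n, of a "unit_vec k"] assms
  by (simp add: sum_unit_vec vnorm_unit_vec)

text \<open>All exponents are treated at once: the norm of a vector equals its pairing with some
  element of the conjugate unit ball, and the norm axioms follow from linearity of the pairing and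
  Hoelder's inequality.\<close>

lemma norm_on_ell: "norm_on (vcarrier (ell p n)) (vnorm (ell p n))"
  unfolding norm_on_def
proof (intro conjI ballI allI)
  fix x y :: "nat \<Rightarrow> real" and c :: real
  show "0 \<le> vnorm (ell p n) x" by (rule ell_norm_ge_0)
  have scale: "vnorm (ell p n) (c *\<^sub>R x) \<le> \<bar>c\<bar> * vnorm (ell p n) x" for c x
  proof -
    obtain y where y: "vnorm (ell p' n) y \<le> 1" "(\<Sum>k<n. (c *\<^sub>R x) k * y k) = vnorm (ell p n) (c *\<^sub>R x)"
      using ell_norming[OF conj n] by metis
    have "vnorm (ell p n) (c *\<^sub>R x) = c * (\<Sum>k<n. x k * y k)"
      by (simp flip: y(2) add: sum_distrib_left mult.assoc)
    also have "\<dots> \<le> \<bar>c\<bar> * \<bar>\<Sum>k<n. x k * y k\<bar>" by (metis abs_ge_self abs_mult)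
    also have "\<dots> \<le> \<bar>c\<bar> * (vnorm (ell p n) x * 1)"
      by (intro mult_left_mono order_trans[OF ell_Hoelder[OF conj n]] y(1) ell_norm_ge_0) simp_all
    finally show ?thesis by simp
  qed
  show "vnorm (ell p n) (c *\<^sub>R x) = \<bar>c\<bar> * vnorm (ell p n) x"
  proof (cases "c = 0")
    case True
    then show ?thesis using scale[of 0 x] ell_norm_ge_0[of "0 *\<^sub>R x"] by simp
  next
    case False
    \<comment> \<open>The reverse inequality is \<open>scale\<close> applied to
      \<open>inverse c\<close> and \<open>c *\<^sub>R x\<close>.\<close>
    have "vnorm (ell p n) x \<le> \<bar>inverse c\<bar> * vnorm (ell p n) (c *\<^sub>R x)"
      using scale[of "inverse c" "c *\<^sub>R x"] False by simp
    then have "\<bar>c\<bar> * vnorm (ell p n) x \<le> vnorm (ell p n) (c *\<^sub>R x)"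
      using False by (simp add: field_simps)
    then show ?thesis using scale[of c x] by simp
  qed
  have zero: "vnorm (ell p n) 0 = 0"
    using scale[of 0 0] ell_norm_ge_0[of 0] by simp
  assume x: "x \<in> vcarrier (ell p n)"
  show "vnorm (ell p n) x = 0 \<longleftrightarrow> x = 0"
  proof
    assume "vnorm (ell p n) x = 0"
    then have "x k = 0" for k
      using ell_coord_le[of k x] x by (cases "k < n") (auto simp: vcarrier_ell)
    then show "x = 0" by auto
  qed (simp add: zero)
  \<comment> \<open>A single \<open>z\<close> norming the sum bounds both summands from
    below.\<close>
  obtain z where z: "vnorm (ell p' n) z \<le> 1" "(\<Sum>k<n. (x + y) k * z k) = vnorm (ell p n) (x + y)"
    using ell_norming[OF conj n] by metis
  have bound: "(\<Sum>k<n. x k * z k) \<le> vnorm (ell p n) x" for x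
    using ell_Hoelder[OF conj n, of x z] mult_left_mono[OF z(1) ell_norm_ge_0[of x]] by simp
  show "vnorm (ell p n) (x + y) \<le> vnorm (ell p n) x + vnorm (ell p n) y"
    using bound[of x] bound[of y] by (simp flip: z(2) add: algebra_simps sum.distrib)
qed

lemma ell_functional_in_dual_ball:
  assumes "vnorm (ell p' n) y \<le> 1"
  shows "(\<lambda>x. \<Sum>k<n. x k * y k) \<in> dual_ball (ell p n)"
  unfolding dual_ball_def
proof (intro CollectI conjI ballI)
  fix x
  show "\<bar>\<Sum>k<n. x k * y k\<bar> \<le> vnorm (ell p n) x"
    using ell_Hoelder[OF conj n, of x y] mult_left_mono[OF assms ell_norm_ge_0[of x]] by simp
qed (auto simp: lin_on_def algebra_simps sum.distrib sum_distrib_left)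

lemma ell_norming_functional: "\<exists>f\<in>dual_ball (ell p n). f v = vnorm (ell p n) v"
  using ell_norming[OF conj n, of v] ell_functional_in_dual_ball by metis

text \<open>The converse comparison to \<open>ell_coord_le\<close>: convergence of the coordinates
  implies convergence in norm. It also shows that operators given by matrices are bounded.\<close>

lemma ell_norm_le_sum:
  assumes "a \<in> vcarrier (ell p n)"
  shows "vnorm (ell p n) a \<le> (\<Sum>k<n. \<bar>a k\<bar>)"
proof -
  have "vnorm (ell p n) (\<Sum>k<n. a k *\<^sub>R unit_vec k) \<le> (\<Sum>k<n. vnorm (ell p n) (a k *\<^sub>R unit_vec k))"
    by (intro norm_on_sum[OF subspace_ell norm_on_ell]) (simp add: subspace_scale subspace_ell unit_vec_in_ell)
  also have "\<dots> = (\<Sum>k<n. \<bar>a k\<bar>)"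
    by (intro sum.cong refl) (simp add: norm_on_scaleR[OF norm_on_ell] unit_vec_in_ell vnorm_unit_vec)
  finally show ?thesis by (simp flip: ell_expansion[OF assms])
qed

lemma banach_space_ell: "banach_space (ell p n)"
  unfolding banach_space_def
proof (intro conjI allI impI subspace_ell norm_on_ell; elim conjE)
  fix \<sigma> :: "nat \<Rightarrow> nat \<Rightarrow> real"
  assume \<sigma>: "range \<sigma> \<subseteq> vcarrier (ell p n)"
    and cauchy: "\<forall>e>0. \<exists>M. \<forall>m\<ge>M. \<forall>k\<ge>M. vnorm (ell p n) (\<sigma> m - \<sigma> k) < e"
  have "Cauchy (\<lambda>m. \<sigma> m k)" if "k < n" for k
    unfolding Cauchy_def dist_real_def
  proof (intro allI impI)
    fix e :: real
    assume "e > 0"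
    then obtain M where "\<And>m l. m \<ge> M \<Longrightarrow> l \<ge> M \<Longrightarrow> vnorm (ell p n) (\<sigma> m - \<sigma> l) < e"
      using cauchy by blast
    then show "\<exists>M. \<forall>m\<ge>M. \<forall>l\<ge>M. \<bar>\<sigma> m k - \<sigma> l k\<bar> < e"
      using le_less_trans[OF ell_coord_le[OF that]] by (metis fun_diff_def)
  qed
  then have "\<forall>k. \<exists>L. k < n \<longrightarrow> (\<lambda>m. \<sigma> m k) \<longlonglongrightarrow> L"
    using Cauchy_convergent convergent_def by blast
  then obtain L where L: "\<And>k. k < n \<Longrightarrow> (\<lambda>m. \<sigma> m k) \<longlonglongrightarrow> L k" by metis
  define x where "x = (\<lambda>k. if k < n then L k else 0)"
  have x: "x \<in> vcarrier (ell p n)" by (simp add: x_def vcarrier_ell)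
  have "(\<lambda>m. \<Sum>k<n. \<bar>\<sigma> m k - L k\<bar>) \<longlonglongrightarrow> (\<Sum>k<n. \<bar>L k - L k\<bar>)"
    by (intro tendsto_intros L) simp
  then have lim: "(\<lambda>m. \<Sum>k<n. \<bar>\<sigma> m k - L k\<bar>) \<longlonglongrightarrow> 0" by simp
  have "vnorm (ell p n) (\<sigma> m - x) \<le> (\<Sum>k<n. \<bar>\<sigma> m k - L k\<bar>)" for m
  proof -
    have "\<sigma> m - x \<in> vcarrier (ell p n)" using \<sigma> x by (intro subspace_diff subspace_ell) auto
    from ell_norm_le_sum[OF this] show ?thesis by (simp add: x_def)
  qed
  then have "(\<lambda>m. vnorm (ell p n) (\<sigma> m - x)) \<longlonglongrightarrow> 0"
    by (intro tendsto_sandwich[OF _ _ tendsto_const lim]) (simp_all add: ell_norm_ge_0)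
  then show "\<exists>x\<in>vcarrier (ell p n). (\<lambda>m. vnorm (ell p n) (\<sigma> m - x)) \<longlonglongrightarrow> 0" using x by blast
qed

end

section \<open>Minimal multinormed spaces\<close>

text \<open>The conclusion of the Hahn-Banach theorem as a property of \<open>E\<close>. For the
  spaces \<open>ell p n\<close> it is supplied by explicit norming vectors.\<close>

definition normed_by_dual :: "('a::real_vector, 'r) nspace_scheme \<Rightarrow> bool" where
  "normed_by_dual E \<longleftrightarrow> (\<forall>x\<in>vcarrier E. \<exists>g\<in>dual_ball E. g x = vnorm E x)"

lemma normed_by_dual_ell:
  "1 / p + 1 / p' = 1 \<Longrightarrow> n \<ge> 1 \<Longrightarrow> normed_by_dual (ell p n)"
  by (simp add: normed_by_dual_def ell_norming_functional)

section \<open>Elementary tensors, pairings and operators on the first factor\<close>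

lemma tensorD: "w \<in> tensor n V \<Longrightarrow> k < n \<Longrightarrow> w k \<in> V"
  "w \<in> tensor n V \<Longrightarrow> n \<le> k \<Longrightarrow> w k = 0"
  by (simp_all add: tensor_def)

lemma elem_tensor_in_tensor:
  assumes "subspace V" "x \<in> V" "a \<in> vcarrier (ell p n)"
  shows "elem_tensor a x \<in> tensor n V"
  using assms by (simp add: tensor_def elem_tensor_def vcarrier_ell subspace_scale)

lemma tensor_expansion:
  assumes "w \<in> tensor n V"
  shows "w = (\<Sum>k<n. elem_tensor (unit_vec k) (w k))"
proof
  fix j
  show "w j = (\<Sum>k<n. elem_tensor (unit_vec k) (w k)) j"
    using assms by (auto simp: tensor_def sum_fun_apply elem_tensor_def unit_vec_def
        if_distrib[of "\<lambda>x. x *\<^sub>R _"] cong: if_cong)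
qed

lemma tensor_left_apply: "tensor_left n T w j = (\<Sum>k<n. T (unit_vec k) j *\<^sub>R w k)"
  by (simp add: tensor_left_def sum_fun_apply elem_tensor_def)

lemma tensor_left_in_tensor:
  assumes "subspace V" "w \<in> tensor n V" "T \<in> bounded_ops (ell p n) (ell p m)"
  shows "tensor_left n T w \<in> tensor m V"
proof -
  have "T (unit_vec k) j = 0" if "k < n" "j \<ge> m" for k j
    using bounded_ops_closed[OF assms(3) unit_vec_in_ell[OF that(1)]] that(2) by (simp add: vcarrier_ell)
  then show ?thesis
    using assms(1,2)
    by (auto simp: tensor_def tensor_left_apply intro!: subspace_sum subspace_scale)
qed

lemma tensor_pairing_add:
  assumes "lin_on V g" "w \<in> tensor n V" "z \<in> tensor n V"
  shows "tensor_pairing n f g (w + z) = tensor_pairing n f g w + tensor_pairing n f g z"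
  using assms by (simp add: tensor_pairing_def lin_on_add[OF assms(1)] tensorD algebra_simps sum.distrib)

lemma tensor_pairing_scaleR:
  assumes "lin_on V g" "w \<in> tensor n V"
  shows "tensor_pairing n f g (c *\<^sub>R w) = c * tensor_pairing n f g w"
  using assms by (simp add: tensor_pairing_def lin_on_scaleR[OF assms(1)] tensorD algebra_simps sum_distrib_left)

lemma tensor_pairing_elem_tensor:
  assumes "lin_on V g" "x \<in> V" "lin_on (vcarrier (ell p n)) f" "a \<in> vcarrier (ell p n)"
  shows "tensor_pairing n f g (elem_tensor a x) = f a * g x"
  using assms
  by (simp add: tensor_pairing_def elem_tensor_def lin_on_scaleR[OF assms(1)]
      lin_on_ell_expansion[OF assms(3,4)] sum_distrib_right sum_distrib_left mult_ac)

text \<open>Moves \<open>T\<close> from the tensor to the functional as its adjoint: expand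
  \<open>f\<close> in the unit vectors and exchange the two finite sums.\<close>

lemma tensor_pairing_tensor_left:
  assumes V: "subspace V" "lin_on V g" "w \<in> tensor n V"
    and f: "lin_on (vcarrier (ell p m)) f" and T: "T \<in> bounded_ops (ell p n) (ell p m)"
  shows "tensor_pairing m f g (tensor_left n T w) = tensor_pairing n (f \<circ> T) g w"
proof -
  have "g (tensor_left n T w j) = (\<Sum>k<n. T (unit_vec k) j * g (w k))" for j
    unfolding tensor_left_apply
    using V by (subst lin_on_sum[OF V(1,2)]) (auto simp: tensorD subspace_scale lin_on_scaleR[OF V(2)])
  then have "tensor_pairing m f g (tensor_left n T w)
      = (\<Sum>k<n. (\<Sum>j<m. T (unit_vec k) j * f (unit_vec j)) * g (w k))"
    by (simp add: tensor_pairing_def sum_distrib_left sum_distrib_right mult_ac sum.swap[of _ "{..<m}"])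
  also have "\<dots> = (\<Sum>k<n. f (T (unit_vec k)) * g (w k))"
    using lin_on_ell_expansion[OF f bounded_ops_closed[OF T]] by (simp add: unit_vec_in_ell)
  finally show ?thesis by (simp add: tensor_pairing_def)
qed

lemma vcarrier_min_space [simp]: "vcarrier (min_space p E) = vcarrier E"
  and vnorm_min_space [simp]: "vnorm (min_space p E) = vnorm E"
  by (simp_all add: min_space_def)

lemma dual_ball_min_space [simp]: "dual_ball (min_space p E) = dual_ball E"
  by (simp add: dual_ball_def)

lemma banach_space_min_space [simp]: "banach_space (min_space p E) = banach_space E"
  by (simp add: banach_space_def)

section \<open>The minimal structure on a Banach space\<close>

context
  fixes p p' :: ennreal and E :: "'a::real_vector nspace"
  assumes conj: "1 / p + 1 / p' = 1" and E: "banach_space E"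
begin

private lemmas subE = banach_space_subspace[OF E]
private lemmas normE = banach_space_norm_on[OF E]

text \<open>Unit vectors have norm 1, so the values of \<open>f\<close> on them are at most 1 in
  modulus. The bound is independent of \<open>f\<close> and \<open>g\<close>, so the supremum in
  \<open>min_space\<close> is over a bounded set.\<close>

lemma tensor_pairing_le_sum:
  assumes "f \<in> dual_ball (ell p n)" "g \<in> dual_ball E" "w \<in> tensor n (vcarrier E)"
  shows "\<bar>tensor_pairing n f g w\<bar> \<le> (\<Sum>k<n. vnorm E (w k))"
proof -
  have "\<bar>f (unit_vec k) * g (w k)\<bar> \<le> 1 * vnorm E (w k)" if "k < n" for k
    unfolding abs_mult
    using dual_ball_bound[OF assms(1) unit_vec_in_ell[OF that]] vnorm_unit_vec[OF that]
      dual_ball_bound[OF assms(2) tensorD(1)[OF assms(3) that]]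
    by (intro mult_mono) auto
  then show ?thesis
    unfolding tensor_pairing_def by (intro order_trans[OF sum_abs] sum_mono) simp
qed

lemma min_tnorm_upper:
  assumes "f \<in> dual_ball (ell p n)" "g \<in> dual_ball E" "w \<in> tensor n (vcarrier E)"
  shows "\<bar>tensor_pairing n f g w\<bar> \<le> tnorm (min_space p E) n w"
  unfolding min_space_def mnspace.simps
  by (intro cSup_upper bdd_aboveI[of _ "\<Sum>k<n. vnorm E (w k)"])
    (use assms tensor_pairing_le_sum in auto)

lemma min_tnorm_least:
  assumes "n \<ge> 1"
    and "\<And>f g. f \<in> dual_ball (ell p n) \<Longrightarrow> g \<in> dual_ball E \<Longrightarrow> \<bar>tensor_pairing n f g w\<bar> \<le> C"
  shows "tnorm (min_space p E) n w \<le> C"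
  unfolding min_space_def mnspace.simps
  by (intro cSup_least)
    (use assms(2) zero_in_dual_ball[OF norm_on_ell[OF conj assms(1)]] zero_in_dual_ball[OF normE] in auto)

lemma min_tnorm_ge_0:
  assumes "n \<ge> 1" "w \<in> tensor n (vcarrier E)"
  shows "0 \<le> tnorm (min_space p E) n w"
  using min_tnorm_upper[OF zero_in_dual_ball[OF norm_on_ell[OF conj assms(1)]] zero_in_dual_ball[OF normE] assms(2)]
  by simp

text \<open>A supremum of moduli of linear functionals is a seminorm. Definiteness uses that
  \<open>E\<close> is normed by its dual: enough pairings exist to detect each coordinate of a
  tensor.\<close>

lemma norm_on_min_tnorm:
  assumes n: "n \<ge> 1" and nrm: "normed_by_dual E"
  shows "norm_on (tensor n (vcarrier E)) (tnorm (min_space p E) n)"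
  unfolding norm_on_def
proof (intro conjI ballI allI)
  fix x y and c :: real
  assume x: "x \<in> tensor n (vcarrier E)"
  have sub: "subspace (tensor n (vcarrier E))" by (intro subspace_tensor subE)
  show "0 \<le> tnorm (min_space p E) n x" by (rule min_tnorm_ge_0[OF n x])
  have scale: "tnorm (min_space p E) n (c *\<^sub>R x) \<le> \<bar>c\<bar> * tnorm (min_space p E) n x"
    if "x \<in> tensor n (vcarrier E)" for c x
  proof (rule min_tnorm_least[OF n])
    fix f g assume fg: "f \<in> dual_ball (ell p n)" "g \<in> dual_ball E"
    show "\<bar>tensor_pairing n f g (c *\<^sub>R x)\<bar> \<le> \<bar>c\<bar> * tnorm (min_space p E) n x"
      using min_tnorm_upper[OF fg that]
      by (simp add: tensor_pairing_scaleR[OF dual_ball_lin_on[OF fg(2)] that] abs_mult mult_left_mono)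
  qed
  show "tnorm (min_space p E) n (c *\<^sub>R x) = \<bar>c\<bar> * tnorm (min_space p E) n x"
  proof (cases "c = 0")
    case True
    then show ?thesis
      using scale[OF x, of 0] min_tnorm_ge_0[OF n, of "0 *\<^sub>R x"] sub by (simp add: subspace_0)
  next
    case False
    have "tnorm (min_space p E) n x \<le> \<bar>inverse c\<bar> * tnorm (min_space p E) n (c *\<^sub>R x)"
      using scale[of "c *\<^sub>R x" "inverse c"] False subspace_scale[OF sub x] by simp
    then have "\<bar>c\<bar> * tnorm (min_space p E) n x \<le> tnorm (min_space p E) n (c *\<^sub>R x)"
      using False by (simp add: field_simps)
    then show ?thesis using scale[OF x, of c] by simp
  qed
  show "tnorm (min_space p E) n x = 0 \<longleftrightarrow> x = 0"
  proof
    assume 0: "tnorm (min_space p E) n x = 0"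
    have "x k = 0" if k: "k < n" for k
    proof -
      obtain g where g: "g \<in> dual_ball E" "g (x k) = vnorm E (x k)"
        using nrm tensorD(1)[OF x k] by (auto simp: normed_by_dual_def)
      \<comment> \<open>The \<open>k\<close>-th coordinate functional has norm at most 1, and its
        pairing with \<open>g\<close> isolates \<open>g (x k)\<close>.\<close>
      define f :: "(nat \<Rightarrow> real) \<Rightarrow> real" where "f a = a k" for a
      have "f \<in> dual_ball (ell p n)"
        by (simp add: f_def dual_ball_def lin_on_def ell_coord_le[OF conj n k])
      from min_tnorm_upper[OF this g(1) x] have "tensor_pairing n f g x = 0" using 0 by simp
      moreover have "tensor_pairing n f g x = (\<Sum>j<n. g (x j) * unit_vec k j)"
        unfolding tensor_pairing_def f_def by (intro sum.cong) (auto simp: unit_vec_def)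
      ultimately have "vnorm E (x k) = 0" by (simp add: sum_unit_vec(2)[OF k, of "\<lambda>j. g (x j)"] g(2))
      then show ?thesis using norm_on_eq_0[OF normE tensorD(1)[OF x k]] by simp
    qed
    then show "x = 0" using tensorD(2)[OF x] by (metis ext leI zero_fun_apply)
  next
    assume "x = 0"
    then show "tnorm (min_space p E) n x = 0"
      using scale[OF x, of 0] min_tnorm_ge_0[OF n x] by simp
  qed
  assume y: "y \<in> tensor n (vcarrier E)"
  show "tnorm (min_space p E) n (x + y) \<le> tnorm (min_space p E) n x + tnorm (min_space p E) n y"
  proof (rule min_tnorm_least[OF n])
    fix f g assume fg: "f \<in> dual_ball (ell p n)" "g \<in> dual_ball E"
    show "\<bar>tensor_pairing n f g (x + y)\<bar> \<le> tnorm (min_space p E) n x + tnorm (min_space p E) n y"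
      using min_tnorm_upper[OF fg x] min_tnorm_upper[OF fg y]
      by (simp add: tensor_pairing_add[OF dual_ball_lin_on[OF fg(2)] x y])
  qed
qed

text \<open>On an elementary tensor the pairing factors as \<open>f a * g x\<close>; norming
  functionals for \<open>a\<close> and for \<open>x\<close> attain the product of the norms.\<close>

lemma min_tnorm_elem_tensor:
  assumes n: "n \<ge> 1" and nrm: "normed_by_dual E"
    and a: "a \<in> vcarrier (ell p n)" and x: "x \<in> vcarrier E"
  shows "tnorm (min_space p E) n (elem_tensor a x) = vnorm (ell p n) a * vnorm E x"
proof (rule antisym)
  show "tnorm (min_space p E) n (elem_tensor a x) \<le> vnorm (ell p n) a * vnorm E x"
  proof (rule min_tnorm_least[OF n])
    fix f g assume fg: "f \<in> dual_ball (ell p n)" "g \<in> dual_ball E"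
    show "\<bar>tensor_pairing n f g (elem_tensor a x)\<bar> \<le> vnorm (ell p n) a * vnorm E x"
      using dual_ball_bound[OF fg(1) a] dual_ball_bound[OF fg(2) x]
      by (simp add: tensor_pairing_elem_tensor[OF dual_ball_lin_on[OF fg(2)] x dual_ball_lin_on[OF fg(1)] a]
          abs_mult mult_mono norm_on_ge_0[OF normE x] ell_norm_ge_0[OF conj n])
  qed
  obtain f where f: "f \<in> dual_ball (ell p n)" "f a = vnorm (ell p n) a"
    using ell_norming_functional[OF conj n] by blast
  obtain g where g: "g \<in> dual_ball E" "g x = vnorm E x"
    using nrm x by (auto simp: normed_by_dual_def)
  have "f a * g x \<le> \<bar>tensor_pairing n f g (elem_tensor a x)\<bar>"
    by (simp add: tensor_pairing_elem_tensor[OF dual_ball_lin_on[OF g(1)] x dual_ball_lin_on[OF f(1)] a])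
  also have "\<dots> \<le> tnorm (min_space p E) n (elem_tensor a x)"
    by (rule min_tnorm_upper[OF f(1) g(1) elem_tensor_in_tensor[OF subE x a]])
  finally show "vnorm (ell p n) a * vnorm E x \<le> tnorm (min_space p E) n (elem_tensor a x)"
    using f g by simp
qed

text \<open>For \<open>C > 0\<close> divide \<open>h\<close> by \<open>C\<close> to reach the dual
  ball. Otherwise \<open>C = 0\<close>, because \<open>C\<close> dominates
  \<open>\<bar>h (unit_vec 0)\<bar>\<close>; then \<open>h\<close> vanishes on the unit vectors and
  the pairing is 0.\<close>

lemma tensor_pairing_bounded:
  assumes n: "n \<ge> 1" and w: "w \<in> tensor n (vcarrier E)" and g: "g \<in> dual_ball E"
    and h: "lin_on (vcarrier (ell p n)) h"
      "\<And>a. a \<in> vcarrier (ell p n) \<Longrightarrow> \<bar>h a\<bar> \<le> C * vnorm (ell p n) a"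
  shows "\<bar>tensor_pairing n h g w\<bar> \<le> C * tnorm (min_space p E) n w"
proof (cases "C > 0")
  case True
  have "(\<lambda>a. h a / C) \<in> dual_ball (ell p n)"
    using h True by (auto simp: dual_ball_def lin_on_def add_divide_distrib divide_le_eq mult.commute)
  from min_tnorm_upper[OF this g w]
  have "\<bar>tensor_pairing n h g w / C\<bar> \<le> tnorm (min_space p E) n w"
    by (simp add: tensor_pairing_def sum_divide_distrib)
  then show ?thesis using True by (simp add: divide_le_eq mult.commute)
next
  case False
  then have "C = 0"
    using h(2)[OF unit_vec_in_ell[of 0 n]] n vnorm_unit_vec[of 0 n p] by simp
  then show ?thesis using h(2)[OF unit_vec_in_ell] by (simp add: tensor_pairing_def)
qed

text \<open>For the operator axiom, pairing \<open>f\<close> with the image under \<open>T\<close>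
  is pairing \<open>f \<circ> T\<close> with the original tensor, and \<open>f \<circ> T\<close> is
  bounded by the operator norm of \<open>T\<close>.\<close>

lemma multinormed_min_space:
  assumes nrm: "normed_by_dual E"
  shows "multinormed p (min_space p E)"
  unfolding multinormed_def vcarrier_min_space vnorm_min_space dual_ball_min_space banach_space_min_space
proof (intro conjI allI impI ballI E)
  fix m n :: nat and T w
  assume m: "m \<ge> 1" and n: "n \<ge> 1" and T: "T \<in> bounded_ops (ell p n) (ell p m)"
    and w: "w \<in> tensor n (vcarrier E)"
  show "tnorm (min_space p E) m (tensor_left n T w)
      \<le> op_norm (ell p n) (ell p m) T * tnorm (min_space p E) n w"
  proof (rule min_tnorm_least[OF m])
    fix f g assume fg: "f \<in> dual_ball (ell p m)" "g \<in> dual_ball E"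
    have "\<bar>(f \<circ> T) a\<bar> \<le> op_norm (ell p n) (ell p m) T * vnorm (ell p n) a"
      if "a \<in> vcarrier (ell p n)" for a
      using dual_ball_bound[OF fg(1) bounded_ops_closed[OF T that]]
        op_norm_bound[OF subspace_ell norm_on_ell[OF conj n] subspace_ell norm_on_ell[OF conj m] T that]
      by simp
    moreover have "lin_on (vcarrier (ell p n)) (f \<circ> T)"
      using bounded_ops_closed[OF T] bounded_ops_lin_on[OF T] dual_ball_lin_on[OF fg(1)]
      by (simp add: lin_on_def)
    ultimately show "\<bar>tensor_pairing m f g (tensor_left n T w)\<bar>
        \<le> op_norm (ell p n) (ell p m) T * tnorm (min_space p E) n w"
      unfolding tensor_pairing_tensor_left[OF subE dual_ball_lin_on[OF fg(2)] w dual_ball_lin_on[OF fg(1)] T]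
      by (intro tensor_pairing_bounded[OF n w fg(2)])
  qed
qed (simp_all add: norm_on_min_tnorm nrm min_tnorm_elem_tensor min_tnorm_upper)

end

section \<open>Sums in the sense of \<open>\<ell>\<^sup>1\<close>\<close>

lemma multinormedD:
  assumes "multinormed p X"
  shows multinormed_banach_space: "banach_space X"
    and multinormed_norm_on: "n \<ge> 1 \<Longrightarrow> norm_on (tensor n (vcarrier X)) (tnorm X n)"
    and multinormed_elem_tensor: "n \<ge> 1 \<Longrightarrow> a \<in> vcarrier (ell p n) \<Longrightarrow> x \<in> vcarrier X \<Longrightarrow>
        tnorm X n (elem_tensor a x) = vnorm (ell p n) a * vnorm X x"
    and multinormed_pairing: "n \<ge> 1 \<Longrightarrow> w \<in> tensor n (vcarrier X) \<Longrightarrow> f \<in> dual_ball (ell p n) \<Longrightarrow>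
        g \<in> dual_ball X \<Longrightarrow> \<bar>tensor_pairing n f g w\<bar> \<le> tnorm X n w"
    and multinormed_tensor_left: "m \<ge> 1 \<Longrightarrow> n \<ge> 1 \<Longrightarrow> T \<in> bounded_ops (ell p n) (ell p m) \<Longrightarrow>
        w \<in> tensor n (vcarrier X) \<Longrightarrow>
        tnorm X m (tensor_left n T w) \<le> op_norm (ell p n) (ell p m) T * tnorm X n w"
    and multinormed_subspace: "subspace (vcarrier X)"
    and multinormed_vnorm_on: "norm_on (vcarrier X) (vnorm X)"
  using assms by (simp_all add: multinormed_def banach_space_subspace banach_space_norm_on)

text \<open>Decompose \<open>w\<close> into elementary tensors with unit vectors, each of which has
  norm \<open>vnorm X (w k)\<close> by the cross-norm axiom. This controls tensor norms by the
  underlying norms of the coordinates, for summability and for limits.\<close>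

lemma tnorm_le_sum:
  assumes X: "multinormed p X" and n: "n \<ge> 1" and w: "w \<in> tensor n (vcarrier X)"
  shows "tnorm X n w \<le> (\<Sum>k<n. vnorm X (w k))"
proof -
  note sub = multinormed_subspace[OF X]
  have "tnorm X n (\<Sum>k<n. elem_tensor (unit_vec k) (w k))
      \<le> (\<Sum>k<n. tnorm X n (elem_tensor (unit_vec k) (w k)))"
    by (intro norm_on_sum[OF subspace_tensor[OF sub] multinormed_norm_on[OF X n]]
        elem_tensor_in_tensor[OF sub, where p = p]) (use w in \<open>auto simp: tensorD unit_vec_in_ell\<close>)
  also have "\<dots> = (\<Sum>k<n. vnorm X (w k))"
    using w by (intro sum.cong refl)
      (auto simp: multinormed_elem_tensor[OF X n] unit_vec_in_ell tensorD vnorm_unit_vec)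
  finally show ?thesis by (simp flip: tensor_expansion[OF w])
qed

lemma has_sum_sum:
  fixes f :: "'k \<Rightarrow> 'i \<Rightarrow> 'a::topological_comm_monoid_add"
  assumes "\<And>k. k \<in> A \<Longrightarrow> (f k has_sum s k) I"
  shows "((\<lambda>i. \<Sum>k\<in>A. f k i) has_sum (\<Sum>k\<in>A. s k)) I"
  using assms by (induction A rule: infinite_finite_induct) (auto intro: has_sum_add)

text \<open>Common to the underlying norm and the tensor norms of an \<open>\<ell>\<^sup>1\<close>
  sum: \<open>\<pi> i\<close> extracts the component in summand \<open>i\<close> of a family or of a
  tensor.\<close>

lemma norm_on_infsum:
  fixes V :: "'v::real_vector set" and \<pi> :: "'i \<Rightarrow> 'v \<Rightarrow> 'w::real_vector"
  assumes W: "\<And>i. i \<in> I \<Longrightarrow> norm_on (W i) (\<nu> i)"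
    and \<pi>: "\<And>i x. i \<in> I \<Longrightarrow> x \<in> V \<Longrightarrow> \<pi> i x \<in> W i" "\<And>i. i \<in> I \<Longrightarrow> lin_on V (\<pi> i)"
    and summable: "\<And>x. x \<in> V \<Longrightarrow> (\<lambda>i. \<nu> i (\<pi> i x)) summable_on I"
    and inj: "\<And>x. x \<in> V \<Longrightarrow> (\<And>i. i \<in> I \<Longrightarrow> \<pi> i x = 0) \<Longrightarrow> x = 0"
    and V: "subspace V"
  shows "norm_on V (\<lambda>x. \<Sum>\<^sub>\<infinity>i\<in>I. \<nu> i (\<pi> i x))"
  unfolding norm_on_def
proof (intro conjI ballI allI)
  fix x y and c :: real
  assume x: "x \<in> V"
  have nonneg: "0 \<le> \<nu> i (\<pi> i x)" if "i \<in> I" for i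
    using norm_on_ge_0[OF W] that \<pi> x by blast
  then show "0 \<le> (\<Sum>\<^sub>\<infinity>i\<in>I. \<nu> i (\<pi> i x))" by (intro infsum_nonneg)
  have scale: "(\<Sum>\<^sub>\<infinity>i\<in>I. \<nu> i (\<pi> i (c *\<^sub>R x))) = \<bar>c\<bar> * (\<Sum>\<^sub>\<infinity>i\<in>I. \<nu> i (\<pi> i x))" for c
  proof -
    have "\<nu> i (\<pi> i (c *\<^sub>R x)) = \<bar>c\<bar> * \<nu> i (\<pi> i x)" if "i \<in> I" for i
      using that \<pi>(1)[OF that x] by (simp add: lin_on_scaleR[OF \<pi>(2)[OF that] x] norm_on_scaleR[OF W])
    then show ?thesis by (simp add: infsum_cmult_right[OF summable[OF x]] cong: infsum_cong)
  qed
  then show "(\<Sum>\<^sub>\<infinity>i\<in>I. \<nu> i (\<pi> i (c *\<^sub>R x))) = \<bar>c\<bar> * (\<Sum>\<^sub>\<infinity>i\<in>I. \<nu> i (\<pi> i x))" .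
  show "(\<Sum>\<^sub>\<infinity>i\<in>I. \<nu> i (\<pi> i x)) = 0 \<longleftrightarrow> x = 0"
  proof
    assume "(\<Sum>\<^sub>\<infinity>i\<in>I. \<nu> i (\<pi> i x)) = 0"
    then have "\<nu> i (\<pi> i x) = 0" if "i \<in> I" for i
      using nonneg_infsum_le_0D[OF _ summable[OF x] nonneg that] by simp
    then have "\<pi> i x = 0" if "i \<in> I" for i
      using norm_on_eq_0[OF W[OF that] \<pi>(1)[OF that x]] that by simp
    then show "x = 0" using inj[OF x] by blast
  next
    assume "x = 0"
    then show "(\<Sum>\<^sub>\<infinity>i\<in>I. \<nu> i (\<pi> i x)) = 0" using scale[of 0] by simp
  qed
  assume y: "y \<in> V"
  have "(\<Sum>\<^sub>\<infinity>i\<in>I. \<nu> i (\<pi> i (x + y))) \<le> (\<Sum>\<^sub>\<infinity>i\<in>I. \<nu> i (\<pi> i x) + \<nu> i (\<pi> i y))"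
  proof (intro infsum_mono summable_on_add summable x y)
    show "x + y \<in> V" using V x y by (rule subspace_add)
    fix i assume i: "i \<in> I"
    show "\<nu> i (\<pi> i (x + y)) \<le> \<nu> i (\<pi> i x) + \<nu> i (\<pi> i y)"
      using norm_on_triangle[OF W[OF i] \<pi>(1)[OF i x] \<pi>(1)[OF i y]]
      by (simp add: lin_on_add[OF \<pi>(2)[OF i] x y])
  qed
  also have "\<dots> = (\<Sum>\<^sub>\<infinity>i\<in>I. \<nu> i (\<pi> i x)) + (\<Sum>\<^sub>\<infinity>i\<in>I. \<nu> i (\<pi> i y))"
    by (intro infsum_add summable x y)
  finally show "(\<Sum>\<^sub>\<infinity>i\<in>I. \<nu> i (\<pi> i (x + y))) \<le>
      (\<Sum>\<^sub>\<infinity>i\<in>I. \<nu> i (\<pi> i x)) + (\<Sum>\<^sub>\<infinity>i\<in>I. \<nu> i (\<pi> i y))" .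
qed

lemma vnorm_l1_sum: "vnorm (l1_sum I X) x = (\<Sum>\<^sub>\<infinity>i\<in>I. vnorm (X i) (x i))"
  by (simp add: l1_sum_def)

lemma tnorm_l1_sum: "tnorm (l1_sum I X) n w = (\<Sum>\<^sub>\<infinity>i\<in>I. tnorm (X i) n (\<lambda>k. w k i))"
  by (simp add: l1_sum_def)

lemma l1_sum_carrier_iff:
  "x \<in> vcarrier (l1_sum I X) \<longleftrightarrow> (\<forall>i\<in>I. x i \<in> vcarrier (X i)) \<and> (\<forall>i. i \<notin> I \<longrightarrow> x i = 0) \<and>
     (\<lambda>i. vnorm (X i) (x i)) summable_on I"
  by (simp add: l1_sum_def)

lemma l1_sum_carrierD:
  assumes "x \<in> vcarrier (l1_sum I X)"
  shows l1_sum_in_carrier: "i \<in> I \<Longrightarrow> x i \<in> vcarrier (X i)"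
    and l1_sum_outside: "i \<notin> I \<Longrightarrow> x i = 0"
    and l1_sum_summable: "(\<lambda>i. vnorm (X i) (x i)) summable_on I"
  using assms by (simp_all add: l1_sum_carrier_iff)

lemma l1_sum_tensor_coord:
  assumes "w \<in> tensor n (vcarrier (l1_sum I X))" "i \<in> I"
  shows "(\<lambda>k. w k i) \<in> tensor n (vcarrier (X i))"
  using assms by (simp add: tensor_def l1_sum_carrier_iff)

definition l1_single :: "'i \<Rightarrow> 'a \<Rightarrow> 'i \<Rightarrow> 'a::zero" where
  "l1_single i y = (\<lambda>j. if j = i then y else 0)"

context
  fixes p :: ennreal and I :: "'i set" and X :: "'i \<Rightarrow> 'a::real_vector mnspace"
  assumes X: "\<And>i. i \<in> I \<Longrightarrow> multinormed p (X i)"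
begin

private lemmas subX = multinormed_subspace[OF X]
private lemmas normX = multinormed_vnorm_on[OF X]

lemma subspace_l1_sum: "subspace (vcarrier (l1_sum I X))"
proof -
  have "(\<lambda>i. vnorm (X i) (x i + y i)) summable_on I"
    if x: "x \<in> vcarrier (l1_sum I X)" and y: "y \<in> vcarrier (l1_sum I X)" for x y
    by (rule summable_on_comparison_test[OF summable_on_add[OF l1_sum_summable[OF x] l1_sum_summable[OF y]]])
      (use x y in \<open>auto simp: l1_sum_in_carrier[OF x] l1_sum_in_carrier[OF y] intro!: norm_on_triangle[OF normX] norm_on_ge_0[OF normX] subspace_add[OF subX]\<close>)
  moreover have "(\<lambda>i. vnorm (X i) (c *\<^sub>R x i)) summable_on I" if x: "x \<in> vcarrier (l1_sum I X)" for c x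
    using summable_on_cmult_right[OF l1_sum_summable[OF x], of "\<bar>c\<bar>"]
    by (rule summable_on_cong[THEN iffD1, rotated]) (simp add: norm_on_scaleR[OF normX] l1_sum_in_carrier[OF x])
  moreover have "(\<lambda>i. vnorm (X i) 0) summable_on I"
    by (rule summable_on_cong[THEN iffD1, OF _ summable_on_0_simp]) (simp add: norm_on_0[OF subX normX])
  ultimately show ?thesis
    unfolding subspace_def
    by (auto simp: l1_sum_carrier_iff subspace_0[OF subX] subspace_add[OF subX] subspace_scale[OF subX])
qed

lemma norm_on_l1_sum: "norm_on (vcarrier (l1_sum I X)) (vnorm (l1_sum I X))"
  unfolding vnorm_l1_sum
proof (rule norm_on_infsum[where W = "\<lambda>i. vcarrier (X i)" and \<pi> = "\<lambda>i x. x i"])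
  fix x assume x: "x \<in> vcarrier (l1_sum I X)" "\<And>i. i \<in> I \<Longrightarrow> x i = 0"
  show "x = 0"
  proof
    fix i
    show "x i = 0 i" using x(2) l1_sum_outside[OF x(1)] by (cases "i \<in> I") simp_all
  qed
qed (rule normX l1_sum_in_carrier l1_sum_summable subspace_l1_sum; assumption | simp add: lin_on_def)+

lemma l1_sum_coord_le:
  assumes "x \<in> vcarrier (l1_sum I X)" "i \<in> I"
  shows "vnorm (X i) (x i) \<le> vnorm (l1_sum I X) x"
  using finite_sum_le_infsum[OF l1_sum_summable[OF assms(1)], of "{i}"] assms
  by (simp add: vnorm_l1_sum norm_on_ge_0[OF normX] l1_sum_in_carrier[OF assms(1)])

text \<open>The limit \<open>x\<close> is formed coordinatewise; bounds on finite partial sums of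
  \<open>\<sigma> m - x\<close> that are uniform in the finite set then give both membership and
  convergence.\<close>

lemma banach_space_l1_sum: "banach_space (l1_sum I X)"
  unfolding banach_space_def
proof (intro conjI allI impI subspace_l1_sum norm_on_l1_sum; elim conjE)
  fix \<sigma> :: "nat \<Rightarrow> 'i \<Rightarrow> 'a"
  assume "range \<sigma> \<subseteq> vcarrier (l1_sum I X)"
    and cauchy: "\<forall>e>0. \<exists>M. \<forall>m\<ge>M. \<forall>n\<ge>M. vnorm (l1_sum I X) (\<sigma> m - \<sigma> n) < e"
  then have \<sigma>: "\<sigma> m \<in> vcarrier (l1_sum I X)" for m by auto
  have diff: "\<sigma> m - \<sigma> n \<in> vcarrier (l1_sum I X)" for m n
    by (intro subspace_diff subspace_l1_sum \<sigma>)
  have "\<exists>y\<in>vcarrier (X i). (\<lambda>k. vnorm (X i) (\<sigma> k i - y)) \<longlonglongrightarrow> 0" if i: "i \<in> I" for i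
  proof -
    have "\<exists>M. \<forall>m\<ge>M. \<forall>n\<ge>M. vnorm (X i) (\<sigma> m i - \<sigma> n i) < e" if e: "e > 0" for e
    proof -
      obtain M where "\<And>m n. m \<ge> M \<Longrightarrow> n \<ge> M \<Longrightarrow> vnorm (l1_sum I X) (\<sigma> m - \<sigma> n) < e"
        using cauchy e by blast
      then show ?thesis using le_less_trans[OF l1_sum_coord_le[OF diff i]] by (metis fun_diff_def)
    qed
    moreover have "range (\<lambda>k. \<sigma> k i) \<subseteq> vcarrier (X i)" using l1_sum_in_carrier[OF \<sigma> i] by auto
    ultimately show ?thesis
      using multinormed_banach_space[OF X[OF i]] unfolding banach_space_def by blast
  qed
  then obtain y where y: "\<And>i. i \<in> I \<Longrightarrow> y i \<in> vcarrier (X i)"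
      "\<And>i. i \<in> I \<Longrightarrow> (\<lambda>k. vnorm (X i) (\<sigma> k i - y i)) \<longlonglongrightarrow> 0"
    by metis
  define x where "x = (\<lambda>i. if i \<in> I then y i else 0)"
  have coord: "\<sigma> m i - x i \<in> vcarrier (X i)" if "i \<in> I" for m i
    using that y(1) l1_sum_in_carrier[OF \<sigma>] by (simp add: x_def subspace_diff[OF subX])
  \<comment> \<open>Insert \<open>\<sigma> n\<close>: the distance from \<open>\<sigma> m\<close> to
    \<open>\<sigma> n\<close> costs at most \<open>e\<close>, and the finitely many remaining
    coordinates tend to 0 as \<open>n\<close> grows.\<close>
  have partial: "(\<Sum>i\<in>F. vnorm (X i) (\<sigma> m i - x i)) \<le> e"
    if F: "finite F" "F \<subseteq> I" and M: "\<And>n. n \<ge> M \<Longrightarrow> vnorm (l1_sum I X) (\<sigma> m - \<sigma> n) \<le> e" for F m M e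
  proof -
    have "(\<Sum>i\<in>F. vnorm (X i) (\<sigma> m i - x i)) \<le> e + (\<Sum>i\<in>F. vnorm (X i) (\<sigma> n i - y i))"
      if n: "n \<ge> M" for n
    proof -
      have "vnorm (X i) (\<sigma> m i - x i) \<le> vnorm (X i) ((\<sigma> m - \<sigma> n) i) + vnorm (X i) (\<sigma> n i - y i)"
        if "i \<in> F" for i
      proof -
        have i: "i \<in> I" using that F by blast
        show ?thesis
          using norm_on_triangle[OF normX[OF i] l1_sum_in_carrier[OF diff i] coord[OF i], of m n n] i
          by (simp add: x_def)
      qed
      then have "(\<Sum>i\<in>F. vnorm (X i) (\<sigma> m i - x i))
          \<le> (\<Sum>i\<in>F. vnorm (X i) ((\<sigma> m - \<sigma> n) i)) + (\<Sum>i\<in>F. vnorm (X i) (\<sigma> n i - y i))"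
        by (simp add: sum_mono flip: sum.distrib)
      also have "(\<Sum>i\<in>F. vnorm (X i) ((\<sigma> m - \<sigma> n) i)) \<le> vnorm (l1_sum I X) (\<sigma> m - \<sigma> n)"
        unfolding vnorm_l1_sum using F
        by (intro finite_sum_le_infsum l1_sum_summable[OF diff] norm_on_ge_0[OF normX] l1_sum_in_carrier[OF diff]) auto
      also have "\<dots> \<le> e" by (rule M[OF n])
      finally show ?thesis by simp
    qed
    moreover have "(\<lambda>n. e + (\<Sum>i\<in>F. vnorm (X i) (\<sigma> n i - y i))) \<longlonglongrightarrow> e + (\<Sum>i\<in>F. 0)"
      using F by (intro tendsto_intros y(2)) auto
    ultimately show ?thesis
      by (intro tendsto_lowerbound[where f = "\<lambda>n. e + (\<Sum>i\<in>F. vnorm (X i) (\<sigma> n i - y i))"])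
        (auto intro: eventually_sequentiallyI[of M])
  qed
  \<comment> \<open>Membership is part of the claim because \<open>x\<close> is not yet known to lie
    in the sum; it follows afterwards from \<open>x = \<sigma> m - (\<sigma> m - x)\<close>.\<close>
  have near: "\<exists>M. \<forall>m\<ge>M. \<sigma> m - x \<in> vcarrier (l1_sum I X) \<and> vnorm (l1_sum I X) (\<sigma> m - x) \<le> e"
    if e: "e > 0" for e
  proof -
    obtain M where "\<And>m n. m \<ge> M \<Longrightarrow> n \<ge> M \<Longrightarrow> vnorm (l1_sum I X) (\<sigma> m - \<sigma> n) < e"
      using cauchy e by blast
    then have M: "\<And>m n. m \<ge> M \<Longrightarrow> n \<ge> M \<Longrightarrow> vnorm (l1_sum I X) (\<sigma> m - \<sigma> n) \<le> e"
      by (rule less_imp_le)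
    have "\<sigma> m - x \<in> vcarrier (l1_sum I X) \<and> vnorm (l1_sum I X) (\<sigma> m - x) \<le> e" if m: "m \<ge> M" for m
    proof -
      have bound: "(\<Sum>i\<in>F. vnorm (X i) (\<sigma> m i - x i)) \<le> e" if "finite F" "F \<subseteq> I" for F
        using partial[OF that M[OF m]] .
      then have summable: "(\<lambda>i. vnorm (X i) (\<sigma> m i - x i)) summable_on I"
        by (intro nonneg_bdd_above_summable_on norm_on_ge_0[OF normX] coord bdd_aboveI2[where M = e]) auto
      have "\<sigma> m - x \<in> vcarrier (l1_sum I X)"
        using summable coord l1_sum_outside[OF \<sigma>] by (simp add: l1_sum_carrier_iff x_def)
      moreover have "vnorm (l1_sum I X) (\<sigma> m - x) \<le> e"
        using infsum_le_finite_sums[OF summable bound] by (simp add: vnorm_l1_sum)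
      ultimately show ?thesis by blast
    qed
    then show ?thesis by blast
  qed
  obtain m where "\<sigma> m - x \<in> vcarrier (l1_sum I X)" using near[OF zero_less_one] by blast
  from subspace_diff[OF subspace_l1_sum \<sigma>[of m] this] have x: "x \<in> vcarrier (l1_sum I X)" by simp
  have "(\<lambda>k. vnorm (l1_sum I X) (\<sigma> k - x)) \<longlonglongrightarrow> 0"
  proof (rule LIMSEQ_I)
    fix e :: real assume e: "e > 0"
    then obtain M where M: "\<And>m. m \<ge> M \<Longrightarrow> vnorm (l1_sum I X) (\<sigma> m - x) \<le> e / 2"
      using near[of "e / 2"] half_gt_zero by blast
    have "norm (vnorm (l1_sum I X) (\<sigma> m - x) - 0) < e" if "m \<ge> M" for m
      using M[OF that] norm_on_ge_0[OF norm_on_l1_sum subspace_diff[OF subspace_l1_sum \<sigma> x], of m] e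
      by simp
    then show "\<exists>M. \<forall>m\<ge>M. norm (vnorm (l1_sum I X) (\<sigma> m - x) - 0) < e" by blast
  qed
  then show "\<exists>x\<in>vcarrier (l1_sum I X). (\<lambda>k. vnorm (l1_sum I X) (\<sigma> k - x)) \<longlonglongrightarrow> 0"
    using x by blast
qed

section \<open>Tensor norms of the sum\<close>

lemma l1_sum_tnorm_summable:
  assumes n: "n \<ge> 1" and w: "w \<in> tensor n (vcarrier (l1_sum I X))"
  shows "(\<lambda>i. tnorm (X i) n (\<lambda>k. w k i)) summable_on I"
proof (rule summable_on_comparison_test)
  have "((\<lambda>i. \<Sum>k<n. vnorm (X i) (w k i)) has_sum (\<Sum>k<n. \<Sum>\<^sub>\<infinity>i\<in>I. vnorm (X i) (w k i))) I"
    by (intro has_sum_sum has_sum_infsum l1_sum_summable tensorD(1)[OF w]) simp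
  then show "(\<lambda>i. \<Sum>k<n. vnorm (X i) (w k i)) summable_on I"
    by (rule has_sum_imp_summable)
  fix i assume i: "i \<in> I"
  note wi = l1_sum_tensor_coord[OF w i]
  show "tnorm (X i) n (\<lambda>k. w k i) \<le> (\<Sum>k<n. vnorm (X i) (w k i))"
    using tnorm_le_sum[OF X[OF i] n wi] .
  show "0 \<le> tnorm (X i) n (\<lambda>k. w k i)"
    using norm_on_ge_0[OF multinormed_norm_on[OF X[OF i] n] wi] .
qed

lemma norm_on_l1_sum_tensor:
  assumes n: "n \<ge> 1"
  shows "norm_on (tensor n (vcarrier (l1_sum I X))) (tnorm (l1_sum I X) n)"
  unfolding tnorm_l1_sum
proof (rule norm_on_infsum[where W = "\<lambda>i. tensor n (vcarrier (X i))" and \<pi> = "\<lambda>i w k. w k i"])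
  fix w assume w: "w \<in> tensor n (vcarrier (l1_sum I X))" and 0: "\<And>i. i \<in> I \<Longrightarrow> (\<lambda>k. w k i) = 0"
  have "w k i = 0" for k i
  proof (cases "i \<in> I")
    case True
    then show ?thesis using 0[of i] by (metis zero_fun_apply)
  next
    case False
    then show ?thesis using tensorD[OF w, of k] l1_sum_outside by (cases "k < n") fastforce+
  qed
  then show "w = 0" by (simp add: fun_eq_iff)
next
  fix i assume i: "i \<in> I"
  show "norm_on (tensor n (vcarrier (X i))) (tnorm (X i) n)"
    by (rule multinormed_norm_on[OF X[OF i] n])
  show "lin_on (tensor n (vcarrier (l1_sum I X))) (\<lambda>w k. w k i)"
    by (simp add: lin_on_def fun_eq_iff)
  show "(\<lambda>k. w k i) \<in> tensor n (vcarrier (X i))" if "w \<in> tensor n (vcarrier (l1_sum I X))" for w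
    by (rule l1_sum_tensor_coord[OF that i])
next
  show "(\<lambda>i. tnorm (X i) n (\<lambda>k. w k i)) summable_on I"
    if "w \<in> tensor n (vcarrier (l1_sum I X))" for w
    by (rule l1_sum_tnorm_summable[OF n that])
qed (rule subspace_tensor[OF subspace_l1_sum])

section \<open>Embedded summands and functionals on the sum\<close>

lemma l1_single_has_sum_norm:
  assumes "i \<in> I"
  shows "((\<lambda>j. vnorm (X j) (l1_single i y j)) has_sum vnorm (X i) y) I"
  by (rule has_sum_finite_neutralI[of "{i}"])
    (use assms in \<open>auto simp: l1_single_def norm_on_0[OF subX normX]\<close>)

lemma l1_single_in_carrier:
  assumes "i \<in> I" "y \<in> vcarrier (X i)"
  shows "l1_single i y \<in> vcarrier (l1_sum I X)"
  unfolding l1_sum_carrier_iff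
proof (intro conjI ballI allI impI)
  show "(\<lambda>j. vnorm (X j) (l1_single i y j)) summable_on I"
    by (rule has_sum_imp_summable[OF l1_single_has_sum_norm[OF assms(1)]])
qed (use assms in \<open>auto simp: l1_single_def subspace_0[OF subX]\<close>)

lemma vnorm_l1_single: "i \<in> I \<Longrightarrow> vnorm (l1_sum I X) (l1_single i y) = vnorm (X i) y"
  unfolding vnorm_l1_sum by (rule infsumI[OF l1_single_has_sum_norm])

text \<open>The embedding of a summand is isometric, so a contractive functional restricts to one;
  this makes the pairing axiom of each summand applicable.\<close>

lemma l1_single_dual_ball:
  assumes "g \<in> dual_ball (l1_sum I X)" "i \<in> I"
  shows "(\<lambda>y. g (l1_single i y)) \<in> dual_ball (X i)"
proof -
  have "l1_single i (x + y) = l1_single i x + l1_single i y"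
    "l1_single i (c *\<^sub>R x) = c *\<^sub>R l1_single i x" for x y :: 'a and c
    by (auto simp: l1_single_def fun_eq_iff)
  moreover have "\<bar>g (l1_single i y)\<bar> \<le> vnorm (X i) y" if "y \<in> vcarrier (X i)" for y
    using dual_ball_bound[OF assms(1) l1_single_in_carrier[OF assms(2) that]] vnorm_l1_single[OF assms(2)]
    by simp
  ultimately show ?thesis
    using dual_ball_lin_on[OF assms(1)] l1_single_in_carrier[OF assms(2)]
    by (simp add: dual_ball_def lin_on_def)
qed

text \<open>Cutting \<open>x\<close> down to a finite set \<open>F\<close> leaves a remainder whose
  norm is exactly the tail of the sum of norms. Contractivity of \<open>g\<close> bounds the error
  by this tail, which tends to 0.\<close>

lemma l1_sum_functional_has_sum:
  assumes g: "g \<in> dual_ball (l1_sum I X)" and x: "x \<in> vcarrier (l1_sum I X)"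
  shows "((\<lambda>i. g (l1_single i (x i))) has_sum g x) I"
proof -
  let ?r = "\<lambda>i. vnorm (X i) (x i)"
  have sing: "l1_single i (x i) \<in> vcarrier (l1_sum I X)" if "i \<in> I" for i
    using l1_single_in_carrier[OF that l1_sum_in_carrier[OF x that]] .
  have tail: "\<bar>(\<Sum>i\<in>F. g (l1_single i (x i))) - g x\<bar> \<le> vnorm (l1_sum I X) x - sum ?r F"
    if F: "finite F" "F \<subseteq> I" for F
  proof -
    let ?z = "x - (\<Sum>i\<in>F. l1_single i (x i))"
    have sum: "(\<Sum>i\<in>F. l1_single i (x i)) \<in> vcarrier (l1_sum I X)"
      using F sing by (intro subspace_sum[OF subspace_l1_sum]) auto
    have z: "?z j = (if j \<in> F then 0 else x j)" for j
      using F by (simp add: sum_fun_apply l1_single_def)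
    have "(?r has_sum sum ?r F) F" using F by simp
    then have "(?r has_sum vnorm (l1_sum I X) x - sum ?r F) (I - F)"
      using has_sum_Diff[OF has_sum_infsum[OF l1_sum_summable[OF x]] _ F(2)] by (simp add: vnorm_l1_sum)
    then have "((\<lambda>i. vnorm (X i) (?z i)) has_sum vnorm (l1_sum I X) x - sum ?r F) I"
      by (rule has_sum_cong_neutral[THEN iffD1, rotated -1])
        (use F in \<open>auto simp: z norm_on_0[OF subX normX] simp del: minus_apply\<close>)
    then have "vnorm (l1_sum I X) ?z = vnorm (l1_sum I X) x - sum ?r F"
      unfolding vnorm_l1_sum by (rule infsumI)
    moreover have "g ?z = g x - (\<Sum>i\<in>F. g (l1_single i (x i)))"
      using F sing
      by (simp add: lin_on_diff[OF subspace_l1_sum dual_ball_lin_on[OF g] x sum]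
          lin_on_sum[OF subspace_l1_sum dual_ball_lin_on[OF g]] subset_iff)
    moreover have "\<bar>g ?z\<bar> \<le> vnorm (l1_sum I X) ?z"
      by (intro dual_ball_bound[OF g] subspace_diff[OF subspace_l1_sum x sum])
    ultimately show ?thesis by (simp add: abs_minus_commute)
  qed
  have "(sum ?r \<longlongrightarrow> vnorm (l1_sum I X) x) (finite_subsets_at_top I)"
    using has_sum_infsum[OF l1_sum_summable[OF x]] by (simp add: has_sum_def vnorm_l1_sum)
  then have "((\<lambda>F. vnorm (l1_sum I X) x - sum ?r F) \<longlongrightarrow> vnorm (l1_sum I X) x - vnorm (l1_sum I X) x)
      (finite_subsets_at_top I)"
    by (intro tendsto_diff tendsto_const)
  then have lim: "((\<lambda>F. vnorm (l1_sum I X) x - sum ?r F) \<longlongrightarrow> 0) (finite_subsets_at_top I)"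
    by simp
  have "((\<lambda>F. (\<Sum>i\<in>F. g (l1_single i (x i))) - g x) \<longlongrightarrow> 0) (finite_subsets_at_top I)"
    by (rule Lim_null_comparison[OF eventually_finite_subsets_at_top_weakI lim]) (simp add: tail)
  then show ?thesis unfolding has_sum_def by (rule LIM_zero_cancel)
qed

text \<open>Each axiom holds in every summand and is summed over \<open>I\<close>. For the pairing
  axiom this requires that the pairing itself is the sum of the pairings with the restrictions of
  \<open>g\<close>.\<close>

lemma multinormed_l1_sum:
  assumes ell: "\<And>n. n \<ge> 1 \<Longrightarrow> norm_on (vcarrier (ell p n)) (vnorm (ell p n))"
  shows "multinormed p (l1_sum I X)"
  unfolding multinormed_def
proof (intro conjI allI impI ballI banach_space_l1_sum norm_on_l1_sum_tensor)
  fix n :: nat and a x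
  assume n: "n \<ge> 1" and a: "a \<in> vcarrier (ell p n)" and x: "x \<in> vcarrier (l1_sum I X)"
  have "tnorm (X i) n (\<lambda>k. elem_tensor a x k i) = vnorm (ell p n) a * vnorm (X i) (x i)" if "i \<in> I" for i
    using multinormed_elem_tensor[OF X[OF that] n a l1_sum_in_carrier[OF x that]]
    by (simp add: elem_tensor_def)
  then show "tnorm (l1_sum I X) n (elem_tensor a x) = vnorm (ell p n) a * vnorm (l1_sum I X) x"
    by (simp add: tnorm_l1_sum vnorm_l1_sum infsum_cmult_right[OF l1_sum_summable[OF x]] cong: infsum_cong)
next
  fix n :: nat and w f g
  assume n: "n \<ge> 1" and w: "w \<in> tensor n (vcarrier (l1_sum I X))"
    and f: "f \<in> dual_ball (ell p n)" and g: "g \<in> dual_ball (l1_sum I X)"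
  have "((\<lambda>i. tensor_pairing n f (\<lambda>y. g (l1_single i y)) (\<lambda>k. w k i)) has_sum tensor_pairing n f g w) I"
    unfolding tensor_pairing_def
    by (intro has_sum_sum has_sum_cmult_right l1_sum_functional_has_sum[OF g]) (simp add: tensorD[OF w])
  from norm_infsum_le[OF this has_sum_infsum[OF l1_sum_tnorm_summable[OF n w]]]
  show "\<bar>tensor_pairing n f g w\<bar> \<le> tnorm (l1_sum I X) n w"
    using multinormed_pairing[OF X n l1_sum_tensor_coord[OF w] f l1_single_dual_ball[OF g]]
    by (simp add: tnorm_l1_sum)
next
  fix m n :: nat and T w
  assume m: "m \<ge> 1" and n: "n \<ge> 1" and T: "T \<in> bounded_ops (ell p n) (ell p m)"
    and w: "w \<in> tensor n (vcarrier (l1_sum I X))"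
  have eq: "(\<lambda>k. tensor_left n T w k i) = tensor_left n T (\<lambda>k. w k i)" for i
    by (simp add: fun_eq_iff tensor_left_apply sum_fun_apply)
  show "tnorm (l1_sum I X) m (tensor_left n T w)
      \<le> op_norm (ell p n) (ell p m) T * tnorm (l1_sum I X) n w"
    unfolding tnorm_l1_sum infsum_cmult_right[OF l1_sum_tnorm_summable[OF n w], symmetric]
  proof (rule infsum_mono)
    show "(\<lambda>i. tnorm (X i) m (\<lambda>k. tensor_left n T w k i)) summable_on I"
      by (intro l1_sum_tnorm_summable[OF m] tensor_left_in_tensor[OF subspace_l1_sum w T])
    show "(\<lambda>i. op_norm (ell p n) (ell p m) T * tnorm (X i) n (\<lambda>k. w k i)) summable_on I"
      by (intro summable_on_cmult_right l1_sum_tnorm_summable[OF n w])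
    fix i assume "i \<in> I"
    then show "tnorm (X i) m (\<lambda>k. tensor_left n T w k i)
        \<le> op_norm (ell p n) (ell p m) T * tnorm (X i) n (\<lambda>k. w k i)"
      unfolding eq by (intro multinormed_tensor_left[OF X m n T] l1_sum_tensor_coord[OF w])
  qed
qed

end

section \<open>The quotient map\<close>

lemma vcarrier_type_mnspace [simp]: "vcarrier (type_mnspace N) = UNIV"
  and vnorm_type_mnspace [simp]: "vnorm (type_mnspace N) = norm"
  and tnorm_type_mnspace [simp]: "tnorm (type_mnspace N) = N"
  by (simp_all add: type_mnspace_def)

section \<open>Gluing contractions on the summands\<close>

context
  fixes p :: ennreal and I :: "'i set" and X :: "'i \<Rightarrow> 'a::real_vector mnspace"
    and N :: "nat \<Rightarrow> (nat \<Rightarrow> 'x::banach) \<Rightarrow> real" and q :: "'i \<Rightarrow> 'a \<Rightarrow> 'x"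
  assumes X: "\<And>i. i \<in> I \<Longrightarrow> multinormed p (X i)"
    and N: "multinormed p (type_mnspace N)"
    and q: "\<And>i. i \<in> I \<Longrightarrow> lin_on (vcarrier (X i)) (q i)"
    and contraction: "\<And>i n w. i \<in> I \<Longrightarrow> n \<ge> 1 \<Longrightarrow> w \<in> tensor n (vcarrier (X i)) \<Longrightarrow>
      N n (tensor_right (q i) w) \<le> tnorm (X i) n w"
begin

private lemmas normN = multinormed_norm_on[OF N, unfolded vcarrier_type_mnspace tnorm_type_mnspace]

text \<open>The case \<open>n = 1\<close> of the contraction property: tensoring with
  \<open>unit_vec 0\<close> is isometric on both sides.\<close>

lemma contraction_norm_le:
  assumes i: "i \<in> I" and x: "x \<in> vcarrier (X i)"
  shows "norm (q i x) \<le> vnorm (X i) x"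
proof -
  have e: "unit_vec 0 \<in> vcarrier (ell p 1)" by (simp add: unit_vec_in_ell)
  have "tensor_right (q i) (elem_tensor (unit_vec 0) x) = elem_tensor (unit_vec 0) (q i x)"
    by (simp add: tensor_right_def elem_tensor_def lin_on_scaleR[OF q[OF i] x])
  then show ?thesis
    using contraction[OF i _ elem_tensor_in_tensor[OF multinormed_subspace[OF X[OF i]] x e]]
      multinormed_elem_tensor[OF N _ e, of "q i x"] multinormed_elem_tensor[OF X[OF i] _ e x]
      vnorm_unit_vec[of 0 1 p]
    by simp
qed

text \<open>The norms are dominated by a summable family, and completeness of the target turns
  absolute into unconditional convergence.\<close>

lemma l1_sum_map_summable:
  assumes x: "x \<in> vcarrier (l1_sum I X)"
  shows "(\<lambda>i. q i (x i)) summable_on I"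
proof (rule abs_summable_summable, rule summable_on_comparison_test)
  show "(\<lambda>i. vnorm (X i) (x i)) summable_on I" by (rule l1_sum_summable[OF x])
  show "norm (q i (x i)) \<le> vnorm (X i) (x i)" if "i \<in> I" for i
    by (rule contraction_norm_le[OF that l1_sum_in_carrier[OF x that]])
qed simp

lemma lin_on_l1_sum_map: "lin_on (vcarrier (l1_sum I X)) (\<lambda>x. \<Sum>\<^sub>\<infinity>i\<in>I. q i (x i))"
  unfolding lin_on_def
proof (intro conjI ballI allI)
  fix x y :: "'i \<Rightarrow> 'a" and c :: real
  assume x: "x \<in> vcarrier (l1_sum I X)"
  have "(\<Sum>\<^sub>\<infinity>i\<in>I. q i ((c *\<^sub>R x) i)) = (\<Sum>\<^sub>\<infinity>i\<in>I. c *\<^sub>R q i (x i))"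
  proof (rule infsum_cong)
    fix i assume i: "i \<in> I"
    show "q i ((c *\<^sub>R x) i) = c *\<^sub>R q i (x i)"
      using lin_on_scaleR[OF q[OF i] l1_sum_in_carrier[OF x i]] by simp
  qed
  also have "\<dots> = c *\<^sub>R (\<Sum>\<^sub>\<infinity>i\<in>I. q i (x i))" by (rule infsum_scaleR_right)
  finally show "(\<Sum>\<^sub>\<infinity>i\<in>I. q i ((c *\<^sub>R x) i)) = c *\<^sub>R (\<Sum>\<^sub>\<infinity>i\<in>I. q i (x i))" .
  assume y: "y \<in> vcarrier (l1_sum I X)"
  have "(\<Sum>\<^sub>\<infinity>i\<in>I. q i ((x + y) i)) = (\<Sum>\<^sub>\<infinity>i\<in>I. q i (x i) + q i (y i))"
  proof (rule infsum_cong)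
    fix i assume i: "i \<in> I"
    show "q i ((x + y) i) = q i (x i) + q i (y i)"
      using lin_on_add[OF q[OF i] l1_sum_in_carrier[OF x i] l1_sum_in_carrier[OF y i]] by simp
  qed
  then show "(\<Sum>\<^sub>\<infinity>i\<in>I. q i ((x + y) i)) = (\<Sum>\<^sub>\<infinity>i\<in>I. q i (x i)) + (\<Sum>\<^sub>\<infinity>i\<in>I. q i (y i))"
    by (simp add: infsum_add l1_sum_map_summable x y)
qed

text \<open>A finite part of the sum is handled by the triangle inequality in the tensor norm. The
  error is controlled by the norms of its \<open>n\<close> coordinates, hence tends to 0 as
  \<open>F\<close> exhausts \<open>I\<close>.\<close>

lemma l1_sum_map_contraction:
  assumes n: "n \<ge> 1" and w: "w \<in> tensor n (vcarrier (l1_sum I X))"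
  shows "N n (tensor_right (\<lambda>x. \<Sum>\<^sub>\<infinity>i\<in>I. q i (x i)) w) \<le> tnorm (l1_sum I X) n w"
proof -
  let ?t = "tnorm (l1_sum I X) n w"
  define Q where "Q x = (\<Sum>\<^sub>\<infinity>i\<in>I. q i (x i))" for x
  have sub: "subspace (tensor n (UNIV :: 'x set))" by (simp add: subspace_tensor)
  have wk: "w k \<in> vcarrier (l1_sum I X)" if "k < n" for k using tensorD(1)[OF w that] .
  \<comment> \<open>The maps must send 0 to 0 so that images of tensors vanish from coordinate
    \<open>n\<close> on.\<close>
  have Q0: "Q 0 = 0"
    unfolding Q_def by (rule lin_on_0[OF subspace_l1_sum[OF X] lin_on_l1_sum_map])
  have q0: "q i 0 = 0" if "i \<in> I" for i
    by (rule lin_on_0[OF multinormed_subspace[OF X[OF that]] q[OF that]])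
  have coord: "tensor_right (q i) (\<lambda>k. w k i) \<in> tensor n UNIV" if "i \<in> I" for i
    using tensorD(2)[OF w] q0[OF that] by (simp add: tensor_def tensor_right_def)
  have bound: "N n (tensor_right Q w) \<le> ?t + (\<Sum>k<n. norm (Q (w k) - (\<Sum>i\<in>F. q i (w k i))))"
    if F: "finite F" "F \<subseteq> I" for F
  proof -
    let ?z = "\<Sum>i\<in>F. tensor_right (q i) (\<lambda>k. w k i)"
    have z: "?z \<in> tensor n UNIV" using F coord by (intro subspace_sum[OF sub]) auto
    have Qw: "tensor_right Q w \<in> tensor n UNIV"
      using tensorD(2)[OF w] Q0 by (simp add: tensor_def tensor_right_def)
    have d: "tensor_right Q w - ?z \<in> tensor n UNIV" by (rule subspace_diff[OF sub Qw z])
    have "N n (tensor_right Q w) = N n (?z + (tensor_right Q w - ?z))" by simp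
    also have "\<dots> \<le> N n ?z + N n (tensor_right Q w - ?z)"
      by (rule norm_on_triangle[OF normN[OF n] z d])
    also have "N n ?z \<le> (\<Sum>i\<in>F. N n (tensor_right (q i) (\<lambda>k. w k i)))"
      using F coord by (intro norm_on_sum[OF sub normN[OF n]]) auto
    also have "\<dots> \<le> (\<Sum>i\<in>F. tnorm (X i) n (\<lambda>k. w k i))"
      using F by (intro sum_mono contraction n l1_sum_tensor_coord[OF w]) auto
    also have "\<dots> \<le> ?t"
      unfolding tnorm_l1_sum
    proof (rule finite_sum_le_infsum[OF l1_sum_tnorm_summable[OF X n w] F])
      fix i assume "i \<in> I - F"
      then have i: "i \<in> I" by simp
      show "0 \<le> tnorm (X i) n (\<lambda>k. w k i)"
        by (rule norm_on_ge_0[OF multinormed_norm_on[OF X[OF i] n] l1_sum_tensor_coord[OF w i]])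
    qed
    also have "N n (tensor_right Q w - ?z) \<le> (\<Sum>k<n. norm ((tensor_right Q w - ?z) k))"
      using tnorm_le_sum[OF N n, unfolded vcarrier_type_mnspace tnorm_type_mnspace vnorm_type_mnspace, OF d] .
    also have "\<dots> = (\<Sum>k<n. norm (Q (w k) - (\<Sum>i\<in>F. q i (w k i))))"
      by (simp add: sum_fun_apply tensor_right_def)
    finally show ?thesis by simp
  qed
  have "((\<lambda>F. \<Sum>i\<in>F. q i (w k i)) \<longlongrightarrow> Q (w k)) (finite_subsets_at_top I)" if "k < n" for k
    using has_sum_infsum[OF l1_sum_map_summable[OF wk[OF that]]] by (simp add: has_sum_def Q_def)
  then have "((\<lambda>F. ?t + (\<Sum>k<n. norm (Q (w k) - (\<Sum>i\<in>F. q i (w k i))))) \<longlongrightarrow>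
      ?t + (\<Sum>k<n. norm (Q (w k) - Q (w k)))) (finite_subsets_at_top I)"
    by (intro tendsto_add tendsto_const tendsto_sum tendsto_norm tendsto_diff) simp
  then have "N n (tensor_right Q w) \<le> ?t + (\<Sum>k<n. norm (Q (w k) - Q (w k)))"
    by (rule tendsto_lowerbound[OF _ eventually_finite_subsets_at_top_weakI finite_subsets_at_top_neq_bot])
      (rule bound)
  then show ?thesis by (simp add: Q_def[abs_def])
qed

end

section \<open>Maps out of the minimal spaces on \<open>ell p' n\<close>\<close>

context
  fixes p p' :: ennreal
  assumes conj: "1 / p + 1 / p' = 1"
begin

private lemmas conj' = conj[unfolded conjugate_exponent_sym[of p p']]

lemma multinormed_min_ell: "n \<ge> 1 \<Longrightarrow> multinormed p (min_space p (ell p' n))"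
  by (intro multinormed_min_space[OF conj] banach_space_ell[OF conj'] normed_by_dual_ell[OF conj'])

text \<open>The operator axiom of \<open>N\<close>, applied to the operator whose matrix has the
  rows \<open>u j\<close>, with its operator norm bounded by the minimal norm of
  \<open>u\<close>.\<close>

lemma combination_contraction:
  fixes N :: "nat \<Rightarrow> (nat \<Rightarrow> 'x::banach) \<Rightarrow> real"
  assumes N: "multinormed p (type_mnspace N)"
    and m: "m \<ge> 1" and n: "n \<ge> 1"
    and w: "w \<in> tensor n UNIV" "N n w \<le> 1"
    and u: "u \<in> tensor m (vcarrier (ell p' n))"
  shows "N m (tensor_right (\<lambda>b. \<Sum>k<n. b k *\<^sub>R w k) u) \<le> tnorm (min_space p (ell p' n)) m u"
proof -
  define T :: "(nat \<Rightarrow> real) \<Rightarrow> nat \<Rightarrow> real" where "T a = (\<lambda>j. \<Sum>k<n. u j k * a k)" for a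
  let ?op = "op_norm (ell p n) (ell p m) T" and ?t = "tnorm (min_space p (ell p' n)) m u"
  have T_closed: "T a \<in> vcarrier (ell p m)" for a
    using tensorD(2)[OF u] by (simp add: T_def vcarrier_ell)
  \<comment> \<open>A crude bound, used only to place \<open>T\<close> in
    \<open>bounded_ops\<close>.\<close>
  have "vnorm (ell p m) (T a) \<le> (\<Sum>j<m. vnorm (ell p' n) (u j)) * vnorm (ell p n) a" for a
  proof -
    have "vnorm (ell p m) (T a) \<le> (\<Sum>j<m. \<bar>T a j\<bar>)" by (rule ell_norm_le_sum[OF conj m T_closed])
    also have "\<dots> \<le> (\<Sum>j<m. vnorm (ell p' n) (u j) * vnorm (ell p n) a)"
      unfolding T_def by (intro sum_mono ell_Hoelder[OF conj' n])
    finally show ?thesis by (simp add: sum_distrib_right)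
  qed
  moreover have "lin_on (vcarrier (ell p n)) T"
    by (simp add: lin_on_def T_def fun_eq_iff algebra_simps sum.distrib sum_distrib_left)
  ultimately have T: "T \<in> bounded_ops (ell p n) (ell p m)"
    using T_closed unfolding bounded_ops_def by blast
  have op: "?op \<le> ?t"
  proof (rule op_norm_le[OF subspace_ell norm_on_ell[OF conj n] subspace_ell norm_on_ell[OF conj m]])
    fix a assume a: "a \<in> vcarrier (ell p n)" "vnorm (ell p n) a \<le> 1"
    obtain f where f: "f \<in> dual_ball (ell p m)" "f (T a) = vnorm (ell p m) (T a)"
      using ell_norming_functional[OF conj m] by blast
    define g :: "(nat \<Rightarrow> real) \<Rightarrow> real" where "g b = (\<Sum>k<n. b k * a k)" for b
    have g: "g \<in> dual_ball (ell p' n)"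
      unfolding g_def[abs_def] by (rule ell_functional_in_dual_ball[OF conj' n a(2)])
    have "f (T a) = (\<Sum>j<m. T a j *\<^sub>R f (unit_vec j))"
      by (rule lin_on_ell_expansion[OF dual_ball_lin_on[OF f(1)] T_closed])
    also have "\<dots> = tensor_pairing m f g u"
      by (simp add: tensor_pairing_def T_def g_def mult.commute)
    also have "\<dots> \<le> ?t"
      using min_tnorm_upper[OF conj banach_space_ell[OF conj' n] f(1) g u] by simp
    finally show "vnorm (ell p m) (T a) \<le> ?t" using f(2) by simp
  qed
  \<comment> \<open>Both sides have \<open>j\<close>-th coordinate
    \<open>\<Sum>k<n. u j k *\<^sub>R w k\<close>, since
    \<open>T (unit_vec k) j = u j k\<close>.\<close>
  have "tensor_right (\<lambda>b. \<Sum>k<n. b k *\<^sub>R w k) u = tensor_left n T w"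
    by (simp add: fun_eq_iff tensor_right_def tensor_left_apply T_def sum_unit_vec)
  then have "N m (tensor_right (\<lambda>b. \<Sum>k<n. b k *\<^sub>R w k) u) \<le> ?op * N n w"
    using multinormed_tensor_left[OF N m n T] w(1) by simp
  also have "\<dots> \<le> ?op * 1"
    by (intro mult_left_mono w(2) op_norm_ge_0[OF subspace_ell norm_on_ell[OF conj n] subspace_ell norm_on_ell[OF conj m] T])
  finally show ?thesis using op by simp
qed

text \<open>The pairing of \<open>f\<close> and \<open>g\<close> with the identity tensor is
  \<open>f v\<close>, where \<open>v\<close> is the coordinate vector of \<open>g\<close>. Its norm
  in \<open>ell p n\<close> is at most 1: it is attained as \<open>g y\<close> for some
  \<open>y\<close> in the unit ball of \<open>ell p' n\<close>.\<close>

lemma min_tnorm_identity: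
  assumes n: "n \<ge> 1"
  shows "tnorm (min_space p (ell p' n)) n (\<lambda>k. if k < n then unit_vec k else 0) \<le> 1"
proof (rule min_tnorm_least[OF conj banach_space_ell[OF conj' n] n])
  fix f g assume f: "f \<in> dual_ball (ell p n)" and g: "g \<in> dual_ball (ell p' n)"
  define v where "v k = (if k < n then g (unit_vec k) else 0)" for k
  have v: "v \<in> vcarrier (ell p n)" by (simp add: v_def vcarrier_ell)
  obtain y where y: "y \<in> vcarrier (ell p' n)" "vnorm (ell p' n) y \<le> 1"
      "(\<Sum>k<n. v k * y k) = vnorm (ell p n) v"
    using ell_norming[OF conj n] .
  have "tensor_pairing n f g (\<lambda>k. if k < n then unit_vec k else 0) = (\<Sum>k<n. v k *\<^sub>R f (unit_vec k))"
    by (simp add: tensor_pairing_def v_def mult.commute)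
  also have "\<dots> = f v" by (rule lin_on_ell_expansion[OF dual_ball_lin_on[OF f] v, symmetric])
  finally have "\<bar>tensor_pairing n f g (\<lambda>k. if k < n then unit_vec k else 0)\<bar> \<le> vnorm (ell p n) v"
    using dual_ball_bound[OF f v] by simp
  also have "\<dots> = (\<Sum>k<n. y k *\<^sub>R g (unit_vec k))" by (simp flip: y(3) add: v_def mult.commute)
  also have "\<dots> = g y" by (rule lin_on_ell_expansion[OF dual_ball_lin_on[OF g] y(1), symmetric])
  also have "\<dots> \<le> 1" using dual_ball_bound[OF g y(1)] y(2) by simp
  finally show "\<bar>tensor_pairing n f g (\<lambda>k. if k < n then unit_vec k else 0)\<bar> \<le> 1" .
qed

end

section \<open>Assembling the quotient map\<close>

theorem proposition4p6:
  fixes p p' :: ennreal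
    and N :: "nat \<Rightarrow> (nat \<Rightarrow> 'x::banach) \<Rightarrow> real"
  assumes "1 \<le> p"
    and "1 / p + 1 / p' = 1"
    and "multinormed p (type_mnspace N)"
  shows "\<exists>(I :: (nat \<times> (nat \<Rightarrow> 'x)) set) (n :: nat \<times> (nat \<Rightarrow> 'x) \<Rightarrow> nat).
           (\<forall>i\<in>I. n i \<ge> 1) \<and>
           is_quotient p (type_mnspace N) (l1_sum I (\<lambda>i. min_space p (ell p' (n i))))"
proof -
  note conj = assms(2) and N = assms(3)
  \<comment> \<open>The tensors themselves serve as indices, so every element of a closed unit ball,
    for every \<open>n\<close>, contributes one summand of dimension \<open>fst i\<close>.\<close>
  define I :: "(nat \<times> (nat \<Rightarrow> 'x)) set" where
    "I = {(n, w). n \<ge> 1 \<and> w \<in> tensor n UNIV \<and> N n w \<le> 1}"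
  define X where "X i = min_space p (ell p' (fst i))" for i :: "nat \<times> (nat \<Rightarrow> 'x)"
  define q :: "nat \<times> (nat \<Rightarrow> 'x) \<Rightarrow> (nat \<Rightarrow> real) \<Rightarrow> 'x"
    where "q i b = (\<Sum>k<fst i. b k *\<^sub>R snd i k)" for i b
  define Q where "Q x = (\<Sum>\<^sub>\<infinity>i\<in>I. q i (x i))" for x
  have I: "fst i \<ge> 1" "snd i \<in> tensor (fst i) UNIV" "N (fst i) (snd i) \<le> 1" if "i \<in> I" for i
    using that by (auto simp: I_def)
  have X: "multinormed p (X i)" if "i \<in> I" for i
    unfolding X_def by (rule multinormed_min_ell[OF conj I(1)[OF that]])
  have q_lin: "lin_on (vcarrier (X i)) (q i)" for i
    unfolding q_def[abs_def] by (rule lin_on_combination)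
  have q_contraction: "N n (tensor_right (q i) w) \<le> tnorm (X i) n w"
    if "i \<in> I" "n \<ge> 1" "w \<in> tensor n (vcarrier (X i))" for i n w
    using combination_contraction[OF conj N that(2) I[OF that(1)]] that(3)
    by (simp add: X_def q_def[abs_def])
  have Q_lin: "lin_on (vcarrier (l1_sum I X)) Q"
    unfolding Q_def[abs_def] by (rule lin_on_l1_sum_map[OF X N q_lin q_contraction])
  have Q_contraction: "N n (tensor_right Q w) \<le> tnorm (l1_sum I X) n w"
    if "n \<ge> 1" "w \<in> tensor n (vcarrier (l1_sum I X))" for n w
    unfolding Q_def[abs_def] by (rule l1_sum_map_contraction[OF X N q_lin q_contraction that])
  have Q0: "Q 0 = 0" by (rule lin_on_0[OF subspace_l1_sum[OF X] Q_lin])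
  have "tensor_right Q ` {w \<in> tensor n (vcarrier (l1_sum I X)). tnorm (l1_sum I X) n w < 1}
      = {w \<in> tensor n UNIV. N n w < 1}" if n: "n \<ge> 1" for n
  proof (intro equalityI subsetI; clarsimp)
    fix w assume w: "w \<in> tensor n (vcarrier (l1_sum I X))" "tnorm (l1_sum I X) n w < 1"
    show "tensor_right Q w \<in> tensor n UNIV \<and> N n (tensor_right Q w) < 1"
      using Q_contraction[OF n w(1)] w tensorD(2)[OF w(1)] Q0 by (simp add: tensor_def tensor_right_def)
  next
    fix w :: "nat \<Rightarrow> 'x" assume w: "w \<in> tensor n UNIV" "N n w < 1"
    have normN: "norm_on (tensor n UNIV) (N n)" using multinormed_norm_on[OF N n] by simp
    \<comment> \<open>The strict inequality leaves room for rescaling: \<open>w\<close> divided by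
      \<open>r\<close> still has norm at most 1, so it is an index, and multiplying its preimage by
      \<open>r\<close> gives norm at most \<open>r\<close>, strictly below 1.\<close>
    obtain r where r: "N n w < r" "r < 1" using dense[OF w(2)] by blast
    have "0 \<le> N n w" using norm_on_ge_0[OF normN w(1)] .
    then have r0: "r > 0" using r by simp
    define i where "i = (n, inverse r *\<^sub>R w)"
    define u where "u = (\<lambda>k. if k < n then unit_vec k else 0)"
    \<comment> \<open>The identity tensor, scaled by \<open>r\<close> and placed in summand
      \<open>i\<close>.\<close>
    define U where "U = (\<lambda>k. l1_single i (r *\<^sub>R u k))"
    have "N n (inverse r *\<^sub>R w) \<le> 1"
      using r r0 by (simp add: norm_on_scaleR[OF normN w(1)] field_simps)
    moreover have "inverse r *\<^sub>R w \<in> tensor n UNIV"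
      using w(1) by (simp add: subspace_scale subspace_tensor)
    ultimately have i: "i \<in> I" using n by (simp add: i_def I_def)
    have u: "u \<in> tensor n (vcarrier (X i))"
      by (simp add: u_def tensor_def X_def i_def unit_vec_in_ell)
    have ru: "r *\<^sub>R u k \<in> vcarrier (X i)" for k
      using tensorD[OF u] multinormed_subspace[OF X[OF i]]
      by (cases "k < n") (simp_all add: subspace_scale subspace_0)
    have "U k \<in> vcarrier (l1_sum I X)" for k
      unfolding U_def by (rule l1_single_in_carrier[where p = p, OF X]) (use i ru in simp_all)
    then have "U \<in> tensor n (vcarrier (l1_sum I X))"
      by (simp add: tensor_def) (simp add: U_def u_def l1_single_def fun_eq_iff)
    moreover have "tnorm (l1_sum I X) n U < 1"
    proof -
      have "((\<lambda>j. tnorm (X j) n (\<lambda>k. U k j)) has_sum tnorm (X i) n (\<lambda>k. U k i)) I"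
      proof (rule has_sum_finite_neutralI[of "{i}"])
        fix j assume j: "j \<in> I - {i}"
        then have "(\<lambda>k. U k j) = 0" by (simp add: U_def l1_single_def fun_eq_iff)
        then show "tnorm (X j) n (\<lambda>k. U k j) = 0"
          using norm_on_0[OF subspace_tensor[OF multinormed_subspace[OF X]] multinormed_norm_on[OF X n], of j] j
          by simp
      qed (use i in simp_all)
      then have "tnorm (l1_sum I X) n U = tnorm (X i) n (\<lambda>k. U k i)"
        unfolding tnorm_l1_sum by (rule infsumI)
      also have "(\<lambda>k. U k i) = r *\<^sub>R u" by (simp add: U_def l1_single_def fun_eq_iff)
      also have "tnorm (X i) n (r *\<^sub>R u) = r * tnorm (X i) n u"
        using norm_on_scaleR[OF multinormed_norm_on[OF X[OF i] n] u] r0 by simp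
      also have "\<dots> \<le> r * 1"
        using min_tnorm_identity[OF conj n] r0
        by (intro mult_left_mono) (simp_all add: X_def i_def u_def)
      finally show ?thesis using r by simp
    qed
    moreover have "tensor_right Q U = w"
    proof
      fix k
      have "((\<lambda>j. q j (U k j)) has_sum q i (U k i)) I"
        by (rule has_sum_finite_neutralI[of "{i}"]) (use i in \<open>auto simp: U_def l1_single_def q_def\<close>)
      then have "tensor_right Q U k = q i (U k i)"
        unfolding tensor_right_def Q_def by (rule infsumI)
      \<comment> \<open>The factor \<open>r\<close> cancels the rescaling in the index, and
        \<open>u k\<close> then picks out \<open>w k\<close>; for \<open>k \<ge> n\<close> both
        sides are 0.\<close>
      also have "\<dots> = (\<Sum>l<n. (r * u k l) *\<^sub>R inverse r *\<^sub>R w l)"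
        by (simp add: q_def i_def U_def l1_single_def)
      also have "\<dots> = (\<Sum>l<n. u k l *\<^sub>R w l)" using r0 by (simp add: field_simps)
      also have "\<dots> = w k"
        using tensorD(2)[OF w(1)]
        by (simp add: u_def unit_vec_def if_distrib[of "\<lambda>c. c *\<^sub>R _"] cong: if_cong)
      finally show "tensor_right Q U k = w k" .
    qed
    ultimately show "w \<in> tensor_right Q ` {w \<in> tensor n (vcarrier (l1_sum I X)). tnorm (l1_sum I X) n w < 1}"
      by blast
  qed
  then have "quotient_map (l1_sum I X) (type_mnspace N) Q"
    using Q_lin by (simp add: quotient_map_def)
  moreover have "multinormed p (l1_sum I X)"
    by (rule multinormed_l1_sum[OF X norm_on_ell[OF conj]])
  ultimately have "is_quotient p (type_mnspace N) (l1_sum I X)"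
    using N unfolding is_quotient_def by blast
  then show ?thesis
    using I(1) by (intro exI[of _ I] exI[of _ fst]) (simp add: X_def[abs_def])
qed

end
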